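(* Let $R$ be an associative ring with unit and let $M$ be a left $R$-module which is $M^{(\Lambda)}$-projective for every index set $\Lambda$ and retractable. If $M$ is a Goldie module and $N$ is a proper fully invariant submodule of $M$ that is a nil-submodule of $M$, then $N$ is a nilpotent submodule of $M$, i.e. $N^\ell=0$ for some integer $\ell>0$.
   Context: Modules are unitary left modules; $S=\operatorname{End}_R(M)$, endomorphisms act on the left and multiplication in $S$ is composition. $M^{(\Lambda)}$ is the direct sum of copies of $M$ indexed by $\Lambda$. A module $M$ is $L$-projective if for every epimorphism $\rho:L\to L'$ and every homomorphism $\alpha:M\to L'$ there is $\overline{\alpha}:M\to L$ with $\rho\overline{\alpha}=\alpha$. $M$ is retractable if $\operatorname{Hom}_R(M,K)\neq 0$ for every nonzero submodule $K$ of $M$. A submodule $N\leq M$ is fully invariant if $f(N)\subseteq N$ for all $f\in S$. $M$ is Goldie if the set $\{\bigcap_{f\in X}\operatorname{Ker} f\mid X\subseteq S\}$ satisfies the ascending chain condition and $M$ has finite uniform dimension. For submodules $A,B\leq M$ the product is $A_MB=\sum\{f(A)\mid f\in\operatorname{Hom}_R(M,B)\}$. Powers: $N^1=N$ and $N^{\ell+1}=(N^\ell)_MN$. A submodule $N$ of $M$ is a nil-submodule if for every $n\in N$ every homomorphism $f:M\to Rn$, regarded as an element of $S$, is nilpotent. *)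

theory Defs
  imports "HOL-Algebra.Module" "HOL.Hull"
begin

section \<open>Unitary left modules over an associative ring with unit\<close>

text \<open>
  The locale \<^locale>\<open>module\<close> of the library requires a commutative base ring, so it is replaced
  here by its exact analogue over a \<^locale>\<open>ring\<close>.  The record type and the locale
  \<^locale>\<open>submodule\<close> (which does not mention commutativity) are those of the library; the
  multiplicative fields of the module record carry no meaning.
\<close>

locale left_module = R?: ring R + M?: abelian_group M
  for R :: "('a, 'r) ring_scheme" (structure) and M :: "('a, 'b, 'm) module_scheme" (structure) +
  assumes smult_closed [simp, intro]:
      "\<lbrakk>a \<in> carrier R; x \<in> carrier M\<rbrakk> \<Longrightarrow> a \<odot>\<^bsub>M\<^esub> x \<in> carrier M"
    and smult_l_distr:
      "\<lbrakk>a \<in> carrier R; b \<in> carrier R; x \<in> carrier M\<rbrakk> \<Longrightarrow>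
        (a \<oplus>\<^bsub>R\<^esub> b) \<odot>\<^bsub>M\<^esub> x = a \<odot>\<^bsub>M\<^esub> x \<oplus>\<^bsub>M\<^esub> b \<odot>\<^bsub>M\<^esub> x"
    and smult_r_distr:
      "\<lbrakk>a \<in> carrier R; x \<in> carrier M; y \<in> carrier M\<rbrakk> \<Longrightarrow>
        a \<odot>\<^bsub>M\<^esub> (x \<oplus>\<^bsub>M\<^esub> y) = a \<odot>\<^bsub>M\<^esub> x \<oplus>\<^bsub>M\<^esub> a \<odot>\<^bsub>M\<^esub> y"
    and smult_assoc:
      "\<lbrakk>a \<in> carrier R; b \<in> carrier R; x \<in> carrier M\<rbrakk> \<Longrightarrow>
        (a \<otimes>\<^bsub>R\<^esub> b) \<odot>\<^bsub>M\<^esub> x = a \<odot>\<^bsub>M\<^esub> (b \<odot>\<^bsub>M\<^esub> x)"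
    and smult_one [simp]:
      "x \<in> carrier M \<Longrightarrow> \<one>\<^bsub>R\<^esub> \<odot>\<^bsub>M\<^esub> x = x"

text \<open>
  As for the library's \<^const>\<open>hom\<close>, homomorphisms are unconstrained outside the carrier of
  their domain; they have to be compared on that carrier only.
\<close>

definition mod_hom ::
    "('a, 'r) ring_scheme \<Rightarrow> ('a, 'b, 'm) module_scheme \<Rightarrow> ('a, 'c, 'n) module_scheme \<Rightarrow> ('b \<Rightarrow> 'c) set"
  where "mod_hom R M N =
    {f \<in> hom (add_monoid M) (add_monoid N).
       \<forall>r\<in>carrier R. \<forall>x\<in>carrier M. f (r \<odot>\<^bsub>M\<^esub> x) = r \<odot>\<^bsub>N\<^esub> f x}"

abbreviation mod_End :: "('a, 'r) ring_scheme \<Rightarrow> ('a, 'b, 'm) module_scheme \<Rightarrow> ('b \<Rightarrow> 'b) set"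
  where "mod_End R M \<equiv> mod_hom R M M"

definition mod_ker :: "('a, 'b, 'm) module_scheme \<Rightarrow> ('a, 'c, 'n) module_scheme \<Rightarrow> ('b \<Rightarrow> 'c) \<Rightarrow> 'b set"
  where "mod_ker M N f = {x \<in> carrier M. f x = \<zero>\<^bsub>N\<^esub>}"

definition nilpotent_endo :: "('a, 'b, 'm) module_scheme \<Rightarrow> ('b \<Rightarrow> 'b) \<Rightarrow> bool"
  where "nilpotent_endo M f \<longleftrightarrow> (\<exists>n>0. \<forall>x\<in>carrier M. (f ^^ n) x = \<zero>\<^bsub>M\<^esub>)"

definition cyclic_submodule :: "('a, 'r) ring_scheme \<Rightarrow> ('a, 'b, 'm) module_scheme \<Rightarrow> 'b \<Rightarrow> 'b set"
  where "cyclic_submodule R M x = {r \<odot>\<^bsub>M\<^esub> x | r. r \<in> carrier R}"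

text \<open>The sum of a family of submodules is the submodule generated by its union.\<close>

definition sum_submodules ::
    "('a, 'r) ring_scheme \<Rightarrow> ('a, 'b, 'm) module_scheme \<Rightarrow> 'b set set \<Rightarrow> 'b set"
  where "sum_submodules R M F = (\<lambda>K. submodule K R M) hull (\<Union>F)"


section \<open>Direct sums of copies and relative projectivity\<close>

text \<open>\<open>M\<^sup>(\<^sup>\<Lambda>\<^sup>)\<close>: finitely supported families with the componentwise operations.\<close>

definition direct_power :: "('a, 'b, 'm) module_scheme \<Rightarrow> 'i set \<Rightarrow> ('a, 'i \<Rightarrow> 'b) module"
  where "direct_power M \<Lambda> =
    \<lparr>carrier = {v \<in> \<Lambda> \<rightarrow>\<^sub>E carrier M. finite {i \<in> \<Lambda>. v i \<noteq> \<zero>\<^bsub>M\<^esub>}},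
     monoid.mult = undefined,
     one = undefined,
     zero = (\<lambda>i\<in>\<Lambda>. \<zero>\<^bsub>M\<^esub>),
     add = (\<lambda>v w. \<lambda>i\<in>\<Lambda>. v i \<oplus>\<^bsub>M\<^esub> w i),
     smult = (\<lambda>r v. \<lambda>i\<in>\<Lambda>. r \<odot>\<^bsub>M\<^esub> v i)\<rparr>"

text \<open>
  \<open>rel_projective R L M\<close> says that \<open>M\<close> is \<open>L\<close>-projective.  The codomain \<open>L'\<close> ranges over modules
  with elements in the element type of \<open>L\<close>; as \<open>L'\<close> is an epimorphic image of \<open>L\<close>, this loses no
  generality, see \<open>rel_projective_lift\<close> below.
\<close>

definition rel_projective ::
    "('a, 'r) ring_scheme \<Rightarrow> ('a, 'l, 'n) module_scheme \<Rightarrow> ('a, 'b, 'm) module_scheme \<Rightarrow> bool"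
  where "rel_projective R L M \<longleftrightarrow>
    (\<forall>L' :: ('a, 'l) module. left_module R L' \<longrightarrow>
      (\<forall>\<rho>\<in>mod_hom R L L'. \<rho> ` carrier L = carrier L' \<longrightarrow>
        (\<forall>\<alpha>\<in>mod_hom R M L'. \<exists>\<beta>\<in>mod_hom R M L. \<forall>x\<in>carrier M. \<rho> (\<beta> x) = \<alpha> x)))"

text \<open>
  \<open>M\<close> is \<open>M\<^sup>(\<^sup>\<Lambda>\<^sup>)\<close>-projective for every index set \<open>\<Lambda>\<close>.  A proposition cannot quantify over the
  types from which index sets are taken.  The index sets contained in the type \<open>'b \<times> nat\<close>, where
  \<open>'b\<close> is the element type of \<open>M\<close>, are sufficient to obtain the property for index sets of
  every type, see \<open>power_projective_any_index\<close> below.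
\<close>

definition power_projective :: "('a, 'r) ring_scheme \<Rightarrow> ('a, 'b, 'm) module_scheme \<Rightarrow> bool"
  where "power_projective R M \<longleftrightarrow>
    (\<forall>\<Lambda> :: ('b \<times> nat) set. rel_projective R (direct_power M \<Lambda>) M)"


section \<open>Retractable and Goldie modules\<close>

definition retractable :: "('a, 'r) ring_scheme \<Rightarrow> ('a, 'b, 'm) module_scheme \<Rightarrow> bool"
  where "retractable R M \<longleftrightarrow>
    (\<forall>K. submodule K R M \<and> K \<noteq> {\<zero>\<^bsub>M\<^esub>} \<longrightarrow>
      (\<exists>f\<in>mod_hom R M (M\<lparr>carrier := K\<rparr>). \<exists>x\<in>carrier M. f x \<noteq> \<zero>\<^bsub>M\<^esub>))"

definition fully_invariant ::
    "('a, 'r) ring_scheme \<Rightarrow> ('a, 'b, 'm) module_scheme \<Rightarrow> 'b set \<Rightarrow> bool"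
  where "fully_invariant R M N \<longleftrightarrow> submodule N R M \<and> (\<forall>f\<in>mod_End R M. f ` N \<subseteq> N)"

definition ascending_chain_condition :: "'x set set \<Rightarrow> bool"
  where "ascending_chain_condition \<C> \<longleftrightarrow>
    (\<forall>C :: nat \<Rightarrow> 'x set. (\<forall>n. C n \<in> \<C>) \<and> (\<forall>n. C n \<subseteq> C (Suc n)) \<longrightarrow> (\<exists>m. \<forall>n\<ge>m. C n = C m))"

definition annihilator_submodules ::
    "('a, 'r) ring_scheme \<Rightarrow> ('a, 'b, 'm) module_scheme \<Rightarrow> 'b set set"
  where "annihilator_submodules R M =
    {carrier M \<inter> (\<Inter>f\<in>X. mod_ker M M f) | X. X \<subseteq> mod_End R M}"

definition uniform_submodule ::
    "('a, 'r) ring_scheme \<Rightarrow> ('a, 'b, 'm) module_scheme \<Rightarrow> 'b set \<Rightarrow> bool"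
  where "uniform_submodule R M U \<longleftrightarrow> submodule U R M \<and> U \<noteq> {\<zero>\<^bsub>M\<^esub>} \<and>
    (\<forall>A B. submodule A R M \<and> A \<subseteq> U \<and> A \<noteq> {\<zero>\<^bsub>M\<^esub>} \<and>
           submodule B R M \<and> B \<subseteq> U \<and> B \<noteq> {\<zero>\<^bsub>M\<^esub>} \<longrightarrow> A \<inter> B \<noteq> {\<zero>\<^bsub>M\<^esub>})"

definition essential_submodule ::
    "('a, 'r) ring_scheme \<Rightarrow> ('a, 'b, 'm) module_scheme \<Rightarrow> 'b set \<Rightarrow> bool"
  where "essential_submodule R M E \<longleftrightarrow> submodule E R M \<and>
    (\<forall>K. submodule K R M \<and> K \<noteq> {\<zero>\<^bsub>M\<^esub>} \<longrightarrow> K \<inter> E \<noteq> {\<zero>\<^bsub>M\<^esub>})"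

definition independent_submodules ::
    "('a, 'r) ring_scheme \<Rightarrow> ('a, 'b, 'm) module_scheme \<Rightarrow> 'i set \<Rightarrow> ('i \<Rightarrow> 'b set) \<Rightarrow> bool"
  where "independent_submodules R M I U \<longleftrightarrow>
    (\<forall>i\<in>I. submodule (U i) R M \<and> U i \<inter> sum_submodules R M (U ` (I - {i})) = {\<zero>\<^bsub>M\<^esub>})"

text \<open>\<open>M\<close> has uniform dimension \<open>n\<close> if some direct sum of \<open>n\<close> uniform submodules is essential in \<open>M\<close>.\<close>

definition finite_uniform_dimension ::
    "('a, 'r) ring_scheme \<Rightarrow> ('a, 'b, 'm) module_scheme \<Rightarrow> bool"
  where "finite_uniform_dimension R M \<longleftrightarrow>
    (\<exists>(n::nat) U. (\<forall>i<n. uniform_submodule R M (U i)) \<and> independent_submodules R M {..<n} U \<and>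
       essential_submodule R M (sum_submodules R M (U ` {..<n})))"

definition Goldie_module :: "('a, 'r) ring_scheme \<Rightarrow> ('a, 'b, 'm) module_scheme \<Rightarrow> bool"
  where "Goldie_module R M \<longleftrightarrow>
    ascending_chain_condition (annihilator_submodules R M) \<and> finite_uniform_dimension R M"


section \<open>Products, nil submodules and nilpotent submodules\<close>

definition submodule_prod ::
    "('a, 'r) ring_scheme \<Rightarrow> ('a, 'b, 'm) module_scheme \<Rightarrow> 'b set \<Rightarrow> 'b set \<Rightarrow> 'b set"
  where "submodule_prod R M A B =
    sum_submodules R M {f ` A | f. f \<in> mod_hom R M (M\<lparr>carrier := B\<rparr>)}"

text \<open>
  The value at exponent \<open>0\<close> is a dummy.  Exponent \<open>1\<close> needs its own clause, as the product of
  \<open>M\<close> and \<open>N\<close> may be strictly smaller than \<open>N\<close>.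
\<close>

fun submodule_power ::
    "('a, 'r) ring_scheme \<Rightarrow> ('a, 'b, 'm) module_scheme \<Rightarrow> 'b set \<Rightarrow> nat \<Rightarrow> 'b set"
  where
    "submodule_power R M N 0 = carrier M"
  | "submodule_power R M N (Suc 0) = N"
  | "submodule_power R M N (Suc (Suc l)) = submodule_prod R M (submodule_power R M N (Suc l)) N"

definition nil_submodule ::
    "('a, 'r) ring_scheme \<Rightarrow> ('a, 'b, 'm) module_scheme \<Rightarrow> 'b set \<Rightarrow> bool"
  where "nil_submodule R M N \<longleftrightarrow> submodule N R M \<and>
    (\<forall>x\<in>N. \<forall>f\<in>mod_hom R M (M\<lparr>carrier := cyclic_submodule R M x\<rparr>). nilpotent_endo M f)"

definition nilpotent_submodule ::
    "('a, 'r) ring_scheme \<Rightarrow> ('a, 'b, 'm) module_scheme \<Rightarrow> 'b set \<Rightarrow> bool"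
  where "nilpotent_submodule R M N \<longleftrightarrow> (\<exists>l>0. submodule_power R M N l = {\<zero>\<^bsub>M\<^esub>})"


section \<open>The type restrictions in the projectivity conditions are harmless\<close>

lemma left_moduleI:
  assumes "ring R" "abelian_group M"
    and "\<And>a x. \<lbrakk>a \<in> carrier R; x \<in> carrier M\<rbrakk> \<Longrightarrow> a \<odot>\<^bsub>M\<^esub> x \<in> carrier M"
    and "\<And>a b x. \<lbrakk>a \<in> carrier R; b \<in> carrier R; x \<in> carrier M\<rbrakk> \<Longrightarrow>
        (a \<oplus>\<^bsub>R\<^esub> b) \<odot>\<^bsub>M\<^esub> x = a \<odot>\<^bsub>M\<^esub> x \<oplus>\<^bsub>M\<^esub> b \<odot>\<^bsub>M\<^esub> x"
    and "\<And>a x y. \<lbrakk>a \<in> carrier R; x \<in> carrier M; y \<in> carrier M\<rbrakk> \<Longrightarrow>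
        a \<odot>\<^bsub>M\<^esub> (x \<oplus>\<^bsub>M\<^esub> y) = a \<odot>\<^bsub>M\<^esub> x \<oplus>\<^bsub>M\<^esub> a \<odot>\<^bsub>M\<^esub> y"
    and "\<And>a b x. \<lbrakk>a \<in> carrier R; b \<in> carrier R; x \<in> carrier M\<rbrakk> \<Longrightarrow>
        (a \<otimes>\<^bsub>R\<^esub> b) \<odot>\<^bsub>M\<^esub> x = a \<odot>\<^bsub>M\<^esub> (b \<odot>\<^bsub>M\<^esub> x)"
    and "\<And>x. x \<in> carrier M \<Longrightarrow> \<one>\<^bsub>R\<^esub> \<odot>\<^bsub>M\<^esub> x = x"
  shows "left_module R M"
  unfolding left_module_def left_module_axioms_def using assms by blast

lemma mod_homI:
  assumes "\<And>x. x \<in> carrier M \<Longrightarrow> f x \<in> carrier N"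
    and "\<And>x y. \<lbrakk>x \<in> carrier M; y \<in> carrier M\<rbrakk> \<Longrightarrow> f (x \<oplus>\<^bsub>M\<^esub> y) = f x \<oplus>\<^bsub>N\<^esub> f y"
    and "\<And>r x. \<lbrakk>r \<in> carrier R; x \<in> carrier M\<rbrakk> \<Longrightarrow> f (r \<odot>\<^bsub>M\<^esub> x) = r \<odot>\<^bsub>N\<^esub> f x"
  shows "f \<in> mod_hom R M N"
  using assms by (auto simp: mod_hom_def hom_def)

lemma mod_homD:
  assumes "f \<in> mod_hom R M N"
  shows "\<And>x. x \<in> carrier M \<Longrightarrow> f x \<in> carrier N"
    and "\<And>x y. \<lbrakk>x \<in> carrier M; y \<in> carrier M\<rbrakk> \<Longrightarrow> f (x \<oplus>\<^bsub>M\<^esub> y) = f x \<oplus>\<^bsub>N\<^esub> f y"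
    and "\<And>r x. \<lbrakk>r \<in> carrier R; x \<in> carrier M\<rbrakk> \<Longrightarrow> f (r \<odot>\<^bsub>M\<^esub> x) = r \<odot>\<^bsub>N\<^esub> f x"
  using assms by (auto simp: mod_hom_def hom_def)

lemma (in left_module) smult_zero_right:
  assumes "r \<in> carrier R"
  shows "r \<odot>\<^bsub>M\<^esub> \<zero>\<^bsub>M\<^esub> = \<zero>\<^bsub>M\<^esub>"
proof -
  have "r \<odot>\<^bsub>M\<^esub> \<zero>\<^bsub>M\<^esub> = r \<odot>\<^bsub>M\<^esub> \<zero>\<^bsub>M\<^esub> \<oplus>\<^bsub>M\<^esub> r \<odot>\<^bsub>M\<^esub> \<zero>\<^bsub>M\<^esub>"
    using smult_r_distr[OF assms, of "\<zero>\<^bsub>M\<^esub>" "\<zero>\<^bsub>M\<^esub>"] by simp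
  then show ?thesis
    using M.add.r_cancel_one' assms by (metis M.zero_closed smult_closed)
qed

lemma mod_hom_zero:
  assumes "left_module R M" "left_module R N" "f \<in> mod_hom R M N"
  shows "f \<zero>\<^bsub>M\<^esub> = \<zero>\<^bsub>N\<^esub>"
proof -
  interpret M: left_module R M by fact
  interpret N: left_module R N by fact
  have "f \<zero>\<^bsub>M\<^esub> = f \<zero>\<^bsub>M\<^esub> \<oplus>\<^bsub>N\<^esub> f \<zero>\<^bsub>M\<^esub>"
    using mod_homD(2)[OF assms(3), of "\<zero>\<^bsub>M\<^esub>" "\<zero>\<^bsub>M\<^esub>"] by simp
  then show ?thesis
    using N.add.r_cancel_one' mod_homD(1)[OF assms(3)] by (metis M.M.zero_closed)
qed

text \<open>Transport of a module structure along a surjection with a section.\<close>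

lemma left_module_direct_power:
  assumes "left_module R M"
  shows "left_module R (direct_power M \<Lambda>)"
proof -
  interpret left_module R M by fact
  have supp_add: "finite {i \<in> \<Lambda>. x i \<oplus>\<^bsub>M\<^esub> y i \<noteq> \<zero>\<^bsub>M\<^esub>}"
    if "x \<in> \<Lambda> \<rightarrow>\<^sub>E carrier M" "y \<in> \<Lambda> \<rightarrow>\<^sub>E carrier M"
       "finite {i \<in> \<Lambda>. x i \<noteq> \<zero>\<^bsub>M\<^esub>}" "finite {i \<in> \<Lambda>. y i \<noteq> \<zero>\<^bsub>M\<^esub>}" for x y
    by (rule finite_subset[of _ "{i \<in> \<Lambda>. x i \<noteq> \<zero>\<^bsub>M\<^esub>} \<union> {i \<in> \<Lambda>. y i \<noteq> \<zero>\<^bsub>M\<^esub>}"]) (use that in auto)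
  have supp_smult: "finite {i \<in> \<Lambda>. r \<odot>\<^bsub>M\<^esub> x i \<noteq> \<zero>\<^bsub>M\<^esub>}"
    if "r \<in> carrier R" "finite {i \<in> \<Lambda>. x i \<noteq> \<zero>\<^bsub>M\<^esub>}" for r x
    by (rule finite_subset[OF _ that(2)]) (use that smult_zero_right in auto)
  have supp_neg: "finite {i \<in> \<Lambda>. \<ominus>\<^bsub>M\<^esub> x i \<noteq> \<zero>\<^bsub>M\<^esub>}"
    if "finite {i \<in> \<Lambda>. x i \<noteq> \<zero>\<^bsub>M\<^esub>}" for x
    by (rule finite_subset[OF _ that]) auto
  have if1: "{i \<in> \<Lambda>. (if i \<in> \<Lambda> then f i else undefined) \<noteq> c} = {i \<in> \<Lambda>. f i \<noteq> c}"
    for f :: "_ \<Rightarrow> 'b" and c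
    by auto
  show ?thesis
  proof (rule left_moduleI)
    show "ring R" ..
    show "abelian_group (direct_power M \<Lambda>)"
    proof (rule abelian_groupI)
      fix x assume "x \<in> carrier (direct_power M \<Lambda>)"
      then have x: "x \<in> \<Lambda> \<rightarrow>\<^sub>E carrier M" "finite {i \<in> \<Lambda>. x i \<noteq> \<zero>\<^bsub>M\<^esub>}"
        by (auto simp: direct_power_def)
      show "\<exists>y\<in>carrier (direct_power M \<Lambda>). y \<oplus>\<^bsub>direct_power M \<Lambda>\<^esub> x = \<zero>\<^bsub>direct_power M \<Lambda>\<^esub>"
      proof (rule bexI)
        show "(\<lambda>i\<in>\<Lambda>. \<ominus>\<^bsub>M\<^esub> x i) \<in> carrier (direct_power M \<Lambda>)"
          using x supp_neg[OF x(2)] by (auto simp: direct_power_def PiE_iff cong: conj_cong)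
        show "(\<lambda>i\<in>\<Lambda>. \<ominus>\<^bsub>M\<^esub> x i) \<oplus>\<^bsub>direct_power M \<Lambda>\<^esub> x = \<zero>\<^bsub>direct_power M \<Lambda>\<^esub>"
          using x by (auto simp: direct_power_def PiE_iff M.l_neg intro!: restrict_ext)
      qed
    qed (auto simp: direct_power_def if1 PiE_iff M.a_assoc M.a_comm M.a_lcomm supp_add extensional_def
           intro!: restrict_ext ext cong: conj_cong)
  qed (auto simp: direct_power_def if1 PiE_iff smult_l_distr smult_r_distr smult_assoc supp_smult
         extensional_def intro!: restrict_ext ext cong: conj_cong)
qed

lemma left_module_image:
  assumes "left_module R L" "left_module R N" "f \<in> mod_hom R L N"
  shows "left_module R (N\<lparr>carrier := f ` carrier L\<rparr>)"
proof -
  interpret L: left_module R L by fact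
  interpret N: left_module R N by fact
  note f = mod_homD[OF assms(3)]
  have add: "f x \<oplus>\<^bsub>N\<^esub> f y \<in> f ` carrier L" if "x \<in> carrier L" "y \<in> carrier L" for x y
    using f(2)[OF that] that by (metis L.M.a_closed imageI)
  have sm: "r \<odot>\<^bsub>N\<^esub> f x \<in> f ` carrier L" if "r \<in> carrier R" "x \<in> carrier L" for r x
    using f(3)[OF that] that by (metis L.smult_closed imageI)
  show ?thesis
  proof (rule left_moduleI)
    show "ring R" ..
    show "abelian_group (N\<lparr>carrier := f ` carrier L\<rparr>)"
    proof (rule abelian_groupI)
      show "\<zero>\<^bsub>N\<lparr>carrier := f ` carrier L\<rparr>\<^esub> \<in> carrier (N\<lparr>carrier := f ` carrier L\<rparr>)"
        using mod_hom_zero[OF assms] by (simp, metis L.M.zero_closed imageI)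
      fix x assume "x \<in> carrier (N\<lparr>carrier := f ` carrier L\<rparr>)"
      then obtain u where u: "u \<in> carrier L" "x = f u" by auto
      have "f (\<ominus>\<^bsub>L\<^esub> u) \<oplus>\<^bsub>N\<^esub> f u = \<zero>\<^bsub>N\<^esub>"
        using f(2)[of "\<ominus>\<^bsub>L\<^esub> u" u] u mod_hom_zero[OF assms] by (simp add: L.M.l_neg)
      then show "\<exists>y\<in>carrier (N\<lparr>carrier := f ` carrier L\<rparr>).
          y \<oplus>\<^bsub>N\<lparr>carrier := f ` carrier L\<rparr>\<^esub> x = \<zero>\<^bsub>N\<lparr>carrier := f ` carrier L\<rparr>\<^esub>"
        using u by auto
    qed (use f(1) add in \<open>auto simp: N.M.a_assoc intro: N.M.a_comm\<close>)
  qed (use f(1) sm in \<open>auto simp: N.smult_l_distr N.smult_r_distr N.smult_assoc\<close>)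
qed

lemma rel_projective_lift:
  fixes L :: "('a, 'l, 'n) module_scheme" and L' :: "('a, 'c, 'k) module_scheme"
  assumes proj: "rel_projective R L M" and L': "left_module R L'"
    and \<rho>: "\<rho> \<in> mod_hom R L L'" "\<rho> ` carrier L = carrier L'" and \<alpha>: "\<alpha> \<in> mod_hom R M L'"
  shows "\<exists>\<beta>\<in>mod_hom R M L. \<forall>x\<in>carrier M. \<rho> (\<beta> x) = \<alpha> x"
proof -
  interpret L': left_module R L' by fact
  define g where "g = inv_into (carrier L) \<rho>"
  have \<rho>g: "\<rho> (g y) = y" if "y \<in> carrier L'" for y
    using that \<rho>(2) by (metis g_def f_inv_into_f)
  define K :: "('a, 'l) module" where
    "K = \<lparr>carrier = g ` carrier L', monoid.mult = undefined, one = undefined, zero = g \<zero>\<^bsub>L'\<^esub>,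
          add = (\<lambda>x y. g (\<rho> x \<oplus>\<^bsub>L'\<^esub> \<rho> y)), smult = (\<lambda>r x. g (r \<odot>\<^bsub>L'\<^esub> \<rho> x))\<rparr>"
  have K: "left_module R K"
  proof (rule left_moduleI)
    show "ring R" ..
    show "abelian_group K"
    proof (rule abelian_groupI)
      fix x assume "x \<in> carrier K"
      then obtain y where y: "y \<in> carrier L'" "x = g y" by (auto simp: K_def)
      show "\<exists>z\<in>carrier K. z \<oplus>\<^bsub>K\<^esub> x = \<zero>\<^bsub>K\<^esub>"
        by (rule bexI[of _ "g (\<ominus>\<^bsub>L'\<^esub> y)"]) (use y in \<open>auto simp: K_def \<rho>g L'.M.l_neg\<close>)
    qed (auto simp: K_def \<rho>g L'.M.a_assoc L'.M.a_comm L'.M.a_lcomm)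
  qed (auto simp: K_def \<rho>g L'.smult_l_distr L'.smult_r_distr L'.smult_assoc)
  have "(\<lambda>x. g (\<rho> x)) \<in> mod_hom R L K"
    using mod_homD[OF \<rho>(1)] by (intro mod_homI) (auto simp: K_def \<rho>g)
  moreover have "(\<lambda>x. g (\<rho> x)) ` carrier L = carrier K"
    using \<rho>(2) by (auto simp: K_def image_image[symmetric])
  moreover have "(\<lambda>x. g (\<alpha> x)) \<in> mod_hom R M K"
    using mod_homD[OF \<alpha>] by (intro mod_homI) (auto simp: K_def \<rho>g)
  ultimately obtain \<beta> where \<beta>: "\<beta> \<in> mod_hom R M L" "\<forall>x\<in>carrier M. g (\<rho> (\<beta> x)) = g (\<alpha> x)"
    using proj K unfolding rel_projective_def by meson
  have "\<rho> (\<beta> x) = \<alpha> x" if "x \<in> carrier M" for x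
    using \<beta> that \<rho>g mod_homD(1)[OF \<rho>(1)] mod_homD(1)[OF \<beta>(1)] mod_homD(1)[OF \<alpha>] by metis
  with \<beta>(1) show ?thesis by blast
qed

theorem power_projective_any_index:
  fixes M :: "('a, 'b, 'm) module_scheme" and \<Lambda> :: "'i set"
  assumes M: "left_module R M" and proj: "power_projective R M"
  shows "rel_projective R (direct_power M \<Lambda>) M"
  unfolding rel_projective_def
proof (intro allI impI ballI)
  fix L' :: "('a, 'i \<Rightarrow> 'b) module" and \<rho> \<alpha>
  assume L': "left_module R L'" and \<rho>: "\<rho> \<in> mod_hom R (direct_power M \<Lambda>) L'"
    and surj: "\<rho> ` carrier (direct_power M \<Lambda>) = carrier L'" and \<alpha>: "\<alpha> \<in> mod_hom R M L'"
  interpret left_module R M by fact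
  have "\<forall>x\<in>carrier M. \<exists>v\<in>carrier (direct_power M \<Lambda>). \<rho> v = \<alpha> x"
    using surj mod_homD(1)[OF \<alpha>] by (metis imageE)
  then obtain p where p: "\<And>x. x \<in> carrier M \<Longrightarrow> p x \<in> carrier (direct_power M \<Lambda>)"
      "\<And>x. x \<in> carrier M \<Longrightarrow> \<rho> (p x) = \<alpha> x"
    by metis
  define S where "S x = {i \<in> \<Lambda>. p x i \<noteq> \<zero>\<^bsub>M\<^esub>}" for x
  have finS: "finite (S x)" if "x \<in> carrier M" for x
    using p(1)[OF that] by (auto simp: S_def direct_power_def)
  define \<Lambda>\<^sub>0 where "\<Lambda>\<^sub>0 = (\<Union>x\<in>carrier M. S x)"
  have sub: "\<Lambda>\<^sub>0 \<subseteq> \<Lambda>" by (auto simp: \<Lambda>\<^sub>0_def S_def)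
  have "\<forall>i\<in>\<Lambda>\<^sub>0. \<exists>x\<in>carrier M. i \<in> S x" by (auto simp: \<Lambda>\<^sub>0_def)
  then obtain q where q: "\<And>i. i \<in> \<Lambda>\<^sub>0 \<Longrightarrow> q i \<in> carrier M" "\<And>i. i \<in> \<Lambda>\<^sub>0 \<Longrightarrow> i \<in> S (q i)"
    by metis
  have "\<forall>x\<in>carrier M. \<exists>e :: 'i \<Rightarrow> nat. inj_on e (S x)"
    using finS finite_imp_inj_to_nat_seg by metis
  then obtain e :: "'b \<Rightarrow> 'i \<Rightarrow> nat" where e: "\<And>x. x \<in> carrier M \<Longrightarrow> inj_on (e x) (S x)"
    by metis
  define h where "h i = (q i, e (q i) i)" for i
  have inj: "inj_on h \<Lambda>\<^sub>0"
  proof (rule inj_onI)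
    fix i j assume ij: "i \<in> \<Lambda>\<^sub>0" "j \<in> \<Lambda>\<^sub>0" "h i = h j"
    then have "q j = q i" "e (q i) i = e (q i) j" by (auto simp: h_def)
    then show "i = j" using e[OF q(1)[OF ij(1)]] q(2) ij by (metis inj_onD)
  qed
  define \<Lambda>\<^sub>1 where "\<Lambda>\<^sub>1 = h ` \<Lambda>\<^sub>0"
  define E where "E v = (\<lambda>i\<in>\<Lambda>. if i \<in> \<Lambda>\<^sub>0 then v (h i) else \<zero>\<^bsub>M\<^esub>)" for v :: "'b \<times> nat \<Rightarrow> 'b"
  have E: "E \<in> mod_hom R (direct_power M \<Lambda>\<^sub>1) (direct_power M \<Lambda>)"
  proof (rule mod_homI)
    fix v assume "v \<in> carrier (direct_power M \<Lambda>\<^sub>1)"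
    then have v: "v \<in> \<Lambda>\<^sub>1 \<rightarrow>\<^sub>E carrier M" "finite {j \<in> \<Lambda>\<^sub>1. v j \<noteq> \<zero>\<^bsub>M\<^esub>}"
      by (auto simp: direct_power_def)
    have "finite {i \<in> \<Lambda>\<^sub>0. v (h i) \<noteq> \<zero>\<^bsub>M\<^esub>}"
    proof (rule finite_imageD)
      show "finite (h ` {i \<in> \<Lambda>\<^sub>0. v (h i) \<noteq> \<zero>\<^bsub>M\<^esub>})"
        by (rule finite_subset[OF _ v(2)]) (auto simp: \<Lambda>\<^sub>1_def)
      show "inj_on h {i \<in> \<Lambda>\<^sub>0. v (h i) \<noteq> \<zero>\<^bsub>M\<^esub>}"
        by (rule inj_on_subset[OF inj]) auto
    qed
    moreover have "{i \<in> \<Lambda>. E v i \<noteq> \<zero>\<^bsub>M\<^esub>} = {i \<in> \<Lambda>\<^sub>0. v (h i) \<noteq> \<zero>\<^bsub>M\<^esub>}"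
      using sub by (auto simp: E_def)
    moreover have "E v \<in> \<Lambda> \<rightarrow>\<^sub>E carrier M"
      using v(1) by (auto simp: E_def \<Lambda>\<^sub>1_def PiE_iff)
    ultimately show "E v \<in> carrier (direct_power M \<Lambda>)"
      by (simp add: direct_power_def)
  qed (auto simp: direct_power_def E_def \<Lambda>\<^sub>1_def PiE_iff smult_zero_right intro!: restrict_ext)
  note D1 = left_module_direct_power[OF M, of \<Lambda>\<^sub>1]
  have \<rho>E: "(\<lambda>v. \<rho> (E v)) \<in> mod_hom R (direct_power M \<Lambda>\<^sub>1) L'"
    using mod_homD[OF E] mod_homD[OF \<rho>] by (intro mod_homI) auto
  let ?L = "L'\<lparr>carrier := (\<lambda>v. \<rho> (E v)) ` carrier (direct_power M \<Lambda>\<^sub>1)\<rparr>"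
  have "\<alpha> x \<in> carrier ?L" if x: "x \<in> carrier M" for x
  proof -
    define v where "v = (\<lambda>j\<in>\<Lambda>\<^sub>1. p x (inv_into \<Lambda>\<^sub>0 h j))"
    have px: "p x \<in> \<Lambda> \<rightarrow>\<^sub>E carrier M"
      using p(1)[OF x] by (auto simp: direct_power_def)
    have vh: "v (h i) = p x i" if "i \<in> \<Lambda>\<^sub>0" for i
      using that inj by (simp add: v_def \<Lambda>\<^sub>1_def)
    have "E v = p x"
    proof
      fix i show "E v i = p x i"
        using px vh x by (cases "i \<in> \<Lambda>") (auto simp: E_def \<Lambda>\<^sub>0_def S_def PiE_iff extensional_def)
    qed
    moreover have "v \<in> carrier (direct_power M \<Lambda>\<^sub>1)"
    proof -
      have "{j \<in> \<Lambda>\<^sub>1. v j \<noteq> \<zero>\<^bsub>M\<^esub>} \<subseteq> h ` S x"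
        using vh sub by (auto simp: \<Lambda>\<^sub>1_def S_def)
      then have "finite {j \<in> \<Lambda>\<^sub>1. v j \<noteq> \<zero>\<^bsub>M\<^esub>}"
        using finS[OF x] by (meson finite_imageI finite_subset)
      moreover have "v \<in> \<Lambda>\<^sub>1 \<rightarrow>\<^sub>E carrier M"
      proof (rule PiE_I)
        fix j assume "j \<in> \<Lambda>\<^sub>1"
        then obtain i where "i \<in> \<Lambda>\<^sub>0" "j = h i" by (auto simp: \<Lambda>\<^sub>1_def)
        then show "v j \<in> carrier M" using vh px sub by auto
      qed (simp add: v_def)
      ultimately show ?thesis by (simp add: direct_power_def)
    qed
    ultimately show ?thesis using p(2)[OF x] by (auto intro!: image_eqI[of _ _ v])
  qed
  then have \<alpha>': "\<alpha> \<in> mod_hom R M ?L"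
    using mod_homD[OF \<alpha>] by (intro mod_homI) auto
  have \<rho>': "(\<lambda>v. \<rho> (E v)) \<in> mod_hom R (direct_power M \<Lambda>\<^sub>1) ?L"
    using mod_homD[OF \<rho>E] by (intro mod_homI) auto
  have "rel_projective R (direct_power M \<Lambda>\<^sub>1) M"
    using proj by (simp add: power_projective_def)
  from rel_projective_lift[OF this left_module_image[OF D1 L' \<rho>E] \<rho>' _ \<alpha>']
  obtain \<beta> where \<beta>: "\<beta> \<in> mod_hom R M (direct_power M \<Lambda>\<^sub>1)" "\<forall>x\<in>carrier M. \<rho> (E (\<beta> x)) = \<alpha> x"
    by auto
  have "(\<lambda>x. E (\<beta> x)) \<in> mod_hom R M (direct_power M \<Lambda>)"
    using mod_homD[OF \<beta>(1)] mod_homD[OF E] by (intro mod_homI) auto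
  with \<beta>(2) show "\<exists>\<beta>\<in>mod_hom R M (direct_power M \<Lambda>). \<forall>x\<in>carrier M. \<rho> (\<beta> x) = \<alpha> x"
    by (intro bexI[of _ "\<lambda>x. E (\<beta> x)"]) auto
qed

end

theory Submission
  imports Defs
begin

text \<open>
  Let \<open>J\<close> be the set of all homomorphisms \<open>M \<rightarrow> Rn\<close> with \<open>n \<in> N\<close>; it is closed under composition
  and consists of nilpotent endomorphisms.  By projectivity, every homomorphism \<open>M \<rightarrow> N\<close> lifts through
  the direct sum of the \<open>Rn\<close> and so is a pointwise finite sum of elements of \<open>J\<close>.  Hence \<open>J\<^sup>n = 0\<close> implies
  \<open>N\<^sup>n\<^sup>+\<^sup>1 = 0\<close>, and it remains to show that \<open>J\<close> is nilpotent.

  Let \<open>K\<close> be the largest annihilator of a power \<open>J\<^sup>n\<close>, and call an endomorphism live if its image is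
  not contained in \<open>K\<close>.  If \<open>K \<noteq> M\<close>, there are \<open>a\<^sub>i \<in> J\<close> such that every product
  \<open>p\<^sub>i = a\<^sub>i\<^sub>-\<^sub>1 \<dots> a\<^sub>0\<close> is live and \<open>Ker a\<^sub>i\<close> is maximal subject to \<open>a\<^sub>i p\<^sub>i\<close> being live.  By maximality,
  every \<open>b \<in> J\<close> with \<open>b a\<^sub>i p\<^sub>i\<close> live is injective on the image of \<open>a\<^sub>i\<close>.  For \<open>m > i\<close> the product
  \<open>a\<^sub>i p\<^sub>m\<close> is not live, since otherwise \<open>b = a\<^sub>i a\<^sub>m\<^sub>-\<^sub>1 \<dots> a\<^sub>i\<^sub>+\<^sub>1\<close> would be injective on the image of
  \<open>a\<^sub>i\<close> and map it to itself, although it is nilpotent.  It follows that the images of the \<open>p\<^sub>i\<close> form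
  an infinite direct sum, contrary to finite uniform dimension.
\<close>

section \<open>Submodules and homomorphisms\<close>

context left_module
begin

lemma smult_zero_left:
  assumes "x \<in> carrier M"
  shows "\<zero>\<^bsub>R\<^esub> \<odot>\<^bsub>M\<^esub> x = \<zero>\<^bsub>M\<^esub>"
proof -
  have "\<zero>\<^bsub>R\<^esub> \<odot>\<^bsub>M\<^esub> x = \<zero>\<^bsub>R\<^esub> \<odot>\<^bsub>M\<^esub> x \<oplus>\<^bsub>M\<^esub> \<zero>\<^bsub>R\<^esub> \<odot>\<^bsub>M\<^esub> x"
    using smult_l_distr[of "\<zero>\<^bsub>R\<^esub>" "\<zero>\<^bsub>R\<^esub>" x] assms by simp
  then show ?thesis
    using M.add.r_cancel_one' assms by (metis R.zero_closed smult_closed)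
qed

lemma smult_minus_one:
  assumes "x \<in> carrier M"
  shows "(\<ominus>\<^bsub>R\<^esub> \<one>\<^bsub>R\<^esub>) \<odot>\<^bsub>M\<^esub> x = \<ominus>\<^bsub>M\<^esub> x"
proof -
  have "(\<ominus>\<^bsub>R\<^esub> \<one>\<^bsub>R\<^esub>) \<odot>\<^bsub>M\<^esub> x \<oplus>\<^bsub>M\<^esub> x = \<zero>\<^bsub>M\<^esub>"
    using smult_l_distr[of "\<ominus>\<^bsub>R\<^esub> \<one>\<^bsub>R\<^esub>" "\<one>\<^bsub>R\<^esub>" x] assms
    by (simp add: R.l_neg smult_zero_left)
  then show ?thesis
    using assms by (metis M.minus_equality R.a_inv_closed R.one_closed smult_closed)
qed

text \<open>No closure under negation has to be checked, because \<open>\<ominus>x\<close> is the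
  multiple of \<open>x\<close> by \<open>\<ominus>\<one>\<close>.\<close>

lemma submodule_iff:
  "submodule H R M \<longleftrightarrow> H \<subseteq> carrier M \<and> \<zero>\<^bsub>M\<^esub> \<in> H \<and>
    (\<forall>x\<in>H. \<forall>y\<in>H. x \<oplus>\<^bsub>M\<^esub> y \<in> H) \<and> (\<forall>r\<in>carrier R. \<forall>x\<in>H. r \<odot>\<^bsub>M\<^esub> x \<in> H)" (is "_ \<longleftrightarrow> ?rhs")
proof
  assume "submodule H R M"
  then interpret submodule H R M .
  show ?rhs using subset one_closed m_closed smult_closed by auto
next
  assume H: ?rhs
  then have "\<ominus>\<^bsub>M\<^esub> x \<in> H" if "x \<in> H" for x
    using smult_minus_one that by (metis R.a_inv_closed R.one_closed subsetD)
  with H show "submodule H R M"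
    by (intro submodule.intro subgroup.intro) (auto simp: submodule_axioms_def a_inv_def)
qed

lemma submoduleD:
  assumes "submodule H R M"
  shows "x \<in> H \<Longrightarrow> x \<in> carrier M"
    and "\<zero>\<^bsub>M\<^esub> \<in> H"
    and "x \<in> H \<Longrightarrow> y \<in> H \<Longrightarrow> x \<oplus>\<^bsub>M\<^esub> y \<in> H"
    and "r \<in> carrier R \<Longrightarrow> x \<in> H \<Longrightarrow> r \<odot>\<^bsub>M\<^esub> x \<in> H"
    and "x \<in> H \<Longrightarrow> \<ominus>\<^bsub>M\<^esub> x \<in> H"
    and "x \<in> H \<Longrightarrow> y \<in> H \<Longrightarrow> x \<ominus>\<^bsub>M\<^esub> y \<in> H"
proof -
  show *: "x \<in> H \<Longrightarrow> x \<in> carrier M" "x \<in> H \<Longrightarrow> y \<in> H \<Longrightarrow> x \<oplus>\<^bsub>M\<^esub> y \<in> H"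
    "r \<in> carrier R \<Longrightarrow> x \<in> H \<Longrightarrow> r \<odot>\<^bsub>M\<^esub> x \<in> H" "\<zero>\<^bsub>M\<^esub> \<in> H" for x y r
    using assms unfolding submodule_iff by auto
  show **: "x \<in> H \<Longrightarrow> \<ominus>\<^bsub>M\<^esub> x \<in> H" for x
    using *(1,3) smult_minus_one by (metis R.a_inv_closed R.one_closed)
  show "x \<in> H \<Longrightarrow> y \<in> H \<Longrightarrow> x \<ominus>\<^bsub>M\<^esub> y \<in> H"
    using *(2) ** by (simp add: a_minus_def)
qed

lemma submodule_carrier: "submodule (carrier M) R M"
  by (simp add: submodule_iff)

lemma submodule_zero: "submodule {\<zero>\<^bsub>M\<^esub>} R M"
  by (simp add: submodule_iff smult_zero_right)

lemma submodule_Inter: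
  assumes "F \<noteq> {}" "\<And>H. H \<in> F \<Longrightarrow> submodule H R M"
  shows "submodule (\<Inter>F) R M"
  using assms unfolding submodule_iff by blast

lemma submodule_Int:
  assumes "submodule A R M" "submodule B R M"
  shows "submodule (A \<inter> B) R M"
  using assms unfolding submodule_iff by blast

lemma submodule_sum_submodules:
  assumes "\<And>H. H \<in> F \<Longrightarrow> submodule H R M"
  shows "submodule (sum_submodules R M F) R M"
  unfolding sum_submodules_def hull_def
proof (rule submodule_Inter)
  have "\<Union>F \<subseteq> carrier M" using assms submoduleD(1) by blast
  then show "{H. submodule H R M \<and> \<Union>F \<subseteq> H} \<noteq> {}"
    using submodule_carrier by blast
qed auto

lemma submodule_cyclic:
  assumes x: "x \<in> carrier M"
  shows "submodule (cyclic_submodule R M x) R M"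
  unfolding submodule_iff
proof (intro conjI ballI)
  show "cyclic_submodule R M x \<subseteq> carrier M"
    using x by (auto simp: cyclic_submodule_def)
  show "\<zero>\<^bsub>M\<^esub> \<in> cyclic_submodule R M x"
    using smult_zero_left[OF x] unfolding cyclic_submodule_def
    by (intro CollectI exI[of _ "\<zero>\<^bsub>R\<^esub>"]) simp
next
  fix y z assume "y \<in> cyclic_submodule R M x" "z \<in> cyclic_submodule R M x"
  then obtain r s where "r \<in> carrier R" "s \<in> carrier R" "y = r \<odot>\<^bsub>M\<^esub> x" "z = s \<odot>\<^bsub>M\<^esub> x"
    by (auto simp: cyclic_submodule_def)
  then show "y \<oplus>\<^bsub>M\<^esub> z \<in> cyclic_submodule R M x"
    using x unfolding cyclic_submodule_def
    by (intro CollectI exI[of _ "r \<oplus>\<^bsub>R\<^esub> s"]) (simp add: smult_l_distr)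
next
  fix r y assume "r \<in> carrier R" "y \<in> cyclic_submodule R M x"
  moreover from this(2) obtain s where "s \<in> carrier R" "y = s \<odot>\<^bsub>M\<^esub> x"
    by (auto simp: cyclic_submodule_def)
  ultimately show "r \<odot>\<^bsub>M\<^esub> y \<in> cyclic_submodule R M x"
    using x unfolding cyclic_submodule_def
    by (intro CollectI exI[of _ "r \<otimes>\<^bsub>R\<^esub> s"]) (simp add: smult_assoc)
qed

lemma cyclic_submodule_self:
  assumes "x \<in> carrier M"
  shows "x \<in> cyclic_submodule R M x"
  using assms unfolding cyclic_submodule_def by (intro CollectI exI[of _ "\<one>\<^bsub>R\<^esub>"]) simp

lemma cyclic_submodule_subset:
  assumes "submodule H R M" "x \<in> H"
  shows "cyclic_submodule R M x \<subseteq> H"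
  using submoduleD(4)[OF assms(1) _ assms(2)] by (auto simp: cyclic_submodule_def)

end

section \<open>Composition, kernels and images of homomorphisms\<close>

lemma mod_hom_comp:
  assumes "f \<in> mod_hom R L M" "g \<in> mod_hom R M N"
  shows "g \<circ> f \<in> mod_hom R L N"
  using mod_homD[OF assms(1)] mod_homD[OF assms(2)] by (intro mod_homI) auto

lemma mod_hom_id: "id \<in> mod_hom R M M"
  by (rule mod_homI) auto

lemma mod_hom_restrict_codomain:
  assumes "B \<subseteq> carrier M"
  shows "f \<in> mod_hom R L (M\<lparr>carrier := B\<rparr>) \<longleftrightarrow> f \<in> mod_hom R L M \<and> f ` carrier L \<subseteq> B"
  using assms by (auto simp: mod_hom_def hom_def)

lemma submodule_mod_ker:
  assumes "left_module R L" "left_module R M" "f \<in> mod_hom R L M"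
  shows "submodule (mod_ker L M f) R L"
proof -
  interpret L: left_module R L by fact
  interpret M: left_module R M by fact
  show ?thesis
    using mod_homD[OF assms(3)] mod_hom_zero[OF assms]
    by (auto simp: L.submodule_iff mod_ker_def M.smult_zero_right)
qed

lemma submodule_image:
  assumes "left_module R L" "left_module R M" "f \<in> mod_hom R L M" "submodule H R L"
  shows "submodule (f ` H) R M"
proof -
  interpret L: left_module R L by fact
  interpret M: left_module R M by fact
  note H = L.submoduleD[OF assms(4)]
  note f = mod_homD[OF assms(3)]
  have z: "\<zero>\<^bsub>M\<^esub> \<in> f ` H"
    using mod_hom_zero[OF assms(1-3)] H(2) by (metis imageI)
  have add: "f x \<oplus>\<^bsub>M\<^esub> f y \<in> f ` H" if "x \<in> H" "y \<in> H" for x y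
    using f(2) H(1,3) that by (metis imageI)
  have sm: "r \<odot>\<^bsub>M\<^esub> f x \<in> f ` H" if "r \<in> carrier R" "x \<in> H" for r x
    using f(3) H(1,4) that by (metis imageI)
  show ?thesis
    using f(1) H(1) z add sm by (auto simp: M.submodule_iff)
qed

section \<open>Quotients and lifting through relative projectivity\<close>

text \<open>The quotient is built on chosen coset representatives rather than on cosets, so that its
  elements have the element type of \<open>L\<close>. This is the type over which the codomains in
  \<open>rel_projective\<close> range.\<close>

lemma ex_quotient_module:
  fixes L :: "('a, 'b, 'm) module_scheme"
  assumes L: "left_module R L" and K: "submodule K R L"
  shows "\<exists>(Q :: ('a, 'b) module) \<rho>. left_module R Q \<and> \<rho> \<in> mod_hom R L Q \<and>
    \<rho> ` carrier L = carrier Q \<and>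
    (\<forall>x\<in>carrier L. \<forall>y\<in>carrier L. \<rho> x = \<rho> y \<longleftrightarrow> x \<ominus>\<^bsub>L\<^esub> y \<in> K)"
proof -
  interpret L: left_module R L by fact
  note K = L.submoduleD[OF K]
  define c where "c x = {y \<in> carrier L. y \<ominus>\<^bsub>L\<^esub> x \<in> K}" for x
  \<comment> \<open>The choice depends only on the coset \<open>c x\<close>, so \<open>g\<close> is
    constant on cosets and serves as the projection.\<close>
  define g where "g x = (SOME y. y \<in> c x)" for x
  have refl: "x \<in> c x" if "x \<in> carrier L" for x
    using that K(2) by (simp add: c_def L.M.r_neg a_minus_def)
  have c_eq: "c x = c y \<longleftrightarrow> x \<ominus>\<^bsub>L\<^esub> y \<in> K" if xy: "x \<in> carrier L" "y \<in> carrier L" for x y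
  proof
    assume "c x = c y"
    then show "x \<ominus>\<^bsub>L\<^esub> y \<in> K" using refl[OF xy(1)] by (auto simp: c_def)
  next
    assume k: "x \<ominus>\<^bsub>L\<^esub> y \<in> K"
    then have k': "y \<ominus>\<^bsub>L\<^esub> x \<in> K"
      using K(5)[OF k] xy by (simp add: a_minus_def L.M.minus_add L.M.a_comm)
    have "z \<ominus>\<^bsub>L\<^esub> v = (z \<ominus>\<^bsub>L\<^esub> u) \<oplus>\<^bsub>L\<^esub> (u \<ominus>\<^bsub>L\<^esub> v)"
      if "z \<in> carrier L" "u \<in> carrier L" "v \<in> carrier L" for z u v
      using that by (simp add: a_minus_def L.M.a_assoc L.M.r_neg1)
    then show "c x = c y" using K(3) k k' xy unfolding c_def by (metis (lifting))
  qed
  have g: "g x \<in> carrier L" "g x \<ominus>\<^bsub>L\<^esub> x \<in> K" if "x \<in> carrier L" for x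
    using someI[of "\<lambda>y. y \<in> c x", OF refl[OF that]] by (auto simp: g_def c_def)
  have g_eq: "g x = g y \<longleftrightarrow> x \<ominus>\<^bsub>L\<^esub> y \<in> K" if "x \<in> carrier L" "y \<in> carrier L" for x y
  proof
    assume eq: "g x = g y"
    have "c (g x) = c x" "c (g y) = c y"
      using c_eq g that by auto
    then show "x \<ominus>\<^bsub>L\<^esub> y \<in> K" using eq c_eq[OF that] by simp
  next
    assume "x \<ominus>\<^bsub>L\<^esub> y \<in> K"
    then show "g x = g y" using c_eq[OF that] by (simp add: g_def)
  qed
  have gg: "g (g x) = g x" if "x \<in> carrier L" for x
    using g g_eq that by auto
  \<comment> \<open>This and the next two facts say that an argument may be replaced by its
    representative inside an operation. They reduce the module laws of \<open>Q\<close> to those of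
    \<open>L\<close>.\<close>
  have g_add1: "g (g x \<oplus>\<^bsub>L\<^esub> y) = g (x \<oplus>\<^bsub>L\<^esub> y)" if "x \<in> carrier L" "y \<in> carrier L" for x y
  proof -
    have "(g x \<oplus>\<^bsub>L\<^esub> y) \<ominus>\<^bsub>L\<^esub> (x \<oplus>\<^bsub>L\<^esub> y) = g x \<ominus>\<^bsub>L\<^esub> x"
      using that g by (simp add: a_minus_def L.M.a_comm[of x y] L.M.minus_add L.M.a_assoc L.M.r_neg1 L.M.r_neg2)
    then show ?thesis using g that by (simp add: g_eq)
  qed
  have g_add2: "g (x \<oplus>\<^bsub>L\<^esub> g y) = g (x \<oplus>\<^bsub>L\<^esub> y)" if "x \<in> carrier L" "y \<in> carrier L" for x y
    using g_add1[of y x] that g by (simp add: L.M.a_comm)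
  have g_smult: "g (r \<odot>\<^bsub>L\<^esub> g x) = g (r \<odot>\<^bsub>L\<^esub> x)" if "r \<in> carrier R" "x \<in> carrier L" for r x
  proof -
    have "r \<odot>\<^bsub>L\<^esub> (g x \<ominus>\<^bsub>L\<^esub> x) \<oplus>\<^bsub>L\<^esub> r \<odot>\<^bsub>L\<^esub> x = r \<odot>\<^bsub>L\<^esub> g x"
      using that g by (simp add: a_minus_def L.smult_r_distr[symmetric] L.M.a_assoc L.M.l_neg)
    then have "r \<odot>\<^bsub>L\<^esub> g x \<ominus>\<^bsub>L\<^esub> r \<odot>\<^bsub>L\<^esub> x = r \<odot>\<^bsub>L\<^esub> (g x \<ominus>\<^bsub>L\<^esub> x)"
      using that g by (metis L.M.a_assoc L.M.minus_closed L.M.r_neg L.M.r_zero L.M.a_inv_closed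
          L.smult_closed a_minus_def)
    then show ?thesis using g that K(4) by (simp add: g_eq)
  qed
  define Q :: "('a, 'b) module" where
    "Q = \<lparr>carrier = g ` carrier L, monoid.mult = undefined, one = undefined, zero = g \<zero>\<^bsub>L\<^esub>,
          add = (\<lambda>x y. g (x \<oplus>\<^bsub>L\<^esub> y)), smult = (\<lambda>r x. g (r \<odot>\<^bsub>L\<^esub> x))\<rparr>"
  note simps = Q_def gg g(1) g_add1 g_add2 g_smult
  have "left_module R Q"
  proof (rule left_moduleI)
    show "ring R" ..
    show "abelian_group Q"
    proof (rule abelian_groupI)
      fix x y z assume "x \<in> carrier Q" "y \<in> carrier Q" "z \<in> carrier Q"
      then have "x \<in> carrier L" "y \<in> carrier L" "z \<in> carrier L" using g(1) by (auto simp: Q_def)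
      then show "x \<oplus>\<^bsub>Q\<^esub> y \<oplus>\<^bsub>Q\<^esub> z = x \<oplus>\<^bsub>Q\<^esub> (y \<oplus>\<^bsub>Q\<^esub> z)"
        by (simp add: Q_def g_add1 g_add2 L.M.a_assoc)
    next
      fix x assume "x \<in> carrier Q"
      then obtain y where y: "y \<in> carrier L" "x = g y" by (auto simp: Q_def)
      show "\<exists>z\<in>carrier Q. z \<oplus>\<^bsub>Q\<^esub> x = \<zero>\<^bsub>Q\<^esub>"
        by (rule bexI[of _ "g (\<ominus>\<^bsub>L\<^esub> y)"]) (use y in \<open>auto simp: simps L.M.l_neg\<close>)
    qed (auto simp: simps L.M.a_comm)
    have car: "x \<in> carrier L" if "x \<in> carrier Q" for x
      using that g(1) by (auto simp: Q_def)
    fix a b x y assume "a \<in> carrier R" "b \<in> carrier R" "x \<in> carrier Q" "y \<in> carrier Q"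
    then show "(a \<oplus>\<^bsub>R\<^esub> b) \<odot>\<^bsub>Q\<^esub> x = a \<odot>\<^bsub>Q\<^esub> x \<oplus>\<^bsub>Q\<^esub> b \<odot>\<^bsub>Q\<^esub> x"
      and "(a \<otimes>\<^bsub>R\<^esub> b) \<odot>\<^bsub>Q\<^esub> x = a \<odot>\<^bsub>Q\<^esub> (b \<odot>\<^bsub>Q\<^esub> x)"
      and "a \<odot>\<^bsub>Q\<^esub> (x \<oplus>\<^bsub>Q\<^esub> y) = a \<odot>\<^bsub>Q\<^esub> x \<oplus>\<^bsub>Q\<^esub> a \<odot>\<^bsub>Q\<^esub> y"
      using car[of x] car[of y]
      by (simp_all add: Q_def g(1) g_add1 g_add2 g_smult L.smult_l_distr L.smult_r_distr L.smult_assoc)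
  qed (auto simp: simps)
  moreover have "g \<in> mod_hom R L Q"
    by (rule mod_homI) (auto simp: simps)
  moreover have "g ` carrier L = carrier Q"
    by (simp add: Q_def)
  ultimately show ?thesis using g_eq by blast
qed

text \<open>
  The lift is taken through \<open>L \<rightarrow> L / (T \<inter> Ker \<sigma>)\<close>, whose codomain contains a copy of \<open>\<sigma> ` T\<close>.
\<close>

lemma rel_projective_submodule_lift:
  fixes L :: "('a, 'l, 'n) module_scheme"
  assumes L: "left_module R L" and X: "left_module R X" and M: "left_module R M"
    and proj: "rel_projective R L M"
    and T: "submodule T R L" and \<sigma>: "\<sigma> \<in> mod_hom R L X"
    and f: "f \<in> mod_hom R M X" "f ` carrier M \<subseteq> \<sigma> ` T"
  shows "\<exists>\<beta>\<in>mod_hom R M L. \<forall>x\<in>carrier M. \<beta> x \<in> T \<and> \<sigma> (\<beta> x) = f x"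
proof -
  interpret L: left_module R L by fact
  interpret X: left_module R X by fact
  interpret M: left_module R M by fact
  note T' = L.submoduleD[OF T]
  \<comment> \<open>Intersecting with \<open>T\<close> leaves \<open>L / K\<close> large enough to
    contain \<open>T / (T \<inter> Ker \<sigma>)\<close>, and makes elements congruent to members of
    \<open>T\<close> lie in \<open>T\<close> themselves.\<close>
  define K where "K = T \<inter> mod_ker L X \<sigma>"
  have K: "submodule K R L"
    unfolding K_def using T submodule_mod_ker[OF L X \<sigma>] by (rule L.submodule_Int)
  obtain Q :: "('a, 'l) module" and \<rho> where Q: "left_module R Q" and \<rho>: "\<rho> \<in> mod_hom R L Q"
    "\<rho> ` carrier L = carrier Q"
    and \<rho>_eq: "\<And>x y. x \<in> carrier L \<Longrightarrow> y \<in> carrier L \<Longrightarrow> \<rho> x = \<rho> y \<longleftrightarrow> x \<ominus>\<^bsub>L\<^esub> y \<in> K"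
    using ex_quotient_module[OF L K] by blast
  interpret Q: left_module R Q by fact
  have \<sigma>_minus: "\<sigma> (x \<ominus>\<^bsub>L\<^esub> y) \<oplus>\<^bsub>X\<^esub> \<sigma> y = \<sigma> x" if "x \<in> carrier L" "y \<in> carrier L" for x y
    using mod_homD(2)[OF \<sigma>, of "x \<ominus>\<^bsub>L\<^esub> y" y] that
    by (simp add: a_minus_def L.M.a_assoc L.M.l_neg)
  \<comment> \<open>On \<open>T\<close> the class modulo \<open>K\<close> is determined by the value
    of \<open>\<sigma>\<close>.\<close>
  have T_eq: "\<rho> x = \<rho> y" if "x \<in> T" "y \<in> T" "\<sigma> x = \<sigma> y" for x y
  proof -
    have "\<sigma> (x \<ominus>\<^bsub>L\<^esub> y) = \<zero>\<^bsub>X\<^esub>"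
      using \<sigma>_minus[of x y] that T'(1,6) mod_homD(1)[OF \<sigma>] by (metis X.M.add.r_cancel_one)
    then show ?thesis using that T'(1,6) by (simp add: \<rho>_eq K_def mod_ker_def)
  qed
  have "\<forall>x\<in>carrier M. \<exists>t\<in>T. \<sigma> t = f x" using f(2) by (metis image_iff subsetD imageI)
  \<comment> \<open>The preimages \<open>t x\<close> are arbitrary and \<open>t\<close> need not be
    linear. By \<open>T_eq\<close> the composite with \<open>\<rho>\<close> is nevertheless a
    homomorphism, and it is this composite that gets lifted.\<close>
  then obtain t where t: "\<And>x. x \<in> carrier M \<Longrightarrow> t x \<in> T" "\<And>x. x \<in> carrier M \<Longrightarrow> \<sigma> (t x) = f x"
    by metis
  note tL = T'(1)[OF t(1)]
  have "(\<lambda>x. \<rho> (t x)) \<in> mod_hom R M Q"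
  proof (rule mod_homI)
    fix x assume "x \<in> carrier M"
    then show "\<rho> (t x) \<in> carrier Q" using mod_homD(1)[OF \<rho>(1)] tL by simp
  next
    fix x y assume xy: "x \<in> carrier M" "y \<in> carrier M"
    have "\<rho> (t (x \<oplus>\<^bsub>M\<^esub> y)) = \<rho> (t x \<oplus>\<^bsub>L\<^esub> t y)"
      using xy by (intro T_eq) (simp_all add: t tL T'(3) mod_homD(2)[OF \<sigma>] mod_homD(2)[OF f(1)])
    then show "\<rho> (t (x \<oplus>\<^bsub>M\<^esub> y)) = \<rho> (t x) \<oplus>\<^bsub>Q\<^esub> \<rho> (t y)"
      using mod_homD(2)[OF \<rho>(1)] tL xy by simp
  next
    fix r x assume rx: "r \<in> carrier R" "x \<in> carrier M"
    have "\<rho> (t (r \<odot>\<^bsub>M\<^esub> x)) = \<rho> (r \<odot>\<^bsub>L\<^esub> t x)"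
      using rx by (intro T_eq) (simp_all add: t tL T'(4) mod_homD(3)[OF \<sigma>] mod_homD(3)[OF f(1)])
    then show "\<rho> (t (r \<odot>\<^bsub>M\<^esub> x)) = r \<odot>\<^bsub>Q\<^esub> \<rho> (t x)"
      using mod_homD(3)[OF \<rho>(1)] tL rx by simp
  qed
  then obtain \<beta> where \<beta>: "\<beta> \<in> mod_hom R M L" "\<And>x. x \<in> carrier M \<Longrightarrow> \<rho> (\<beta> x) = \<rho> (t x)"
    using proj Q \<rho> unfolding rel_projective_def by meson
  have "\<beta> x \<in> T \<and> \<sigma> (\<beta> x) = f x" if x: "x \<in> carrier M" for x
  proof -
    note bx = mod_homD(1)[OF \<beta>(1) x]
    \<comment> \<open>\<open>\<beta> x\<close> differs from \<open>t x\<close> by an element of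
      \<open>T\<close> that \<open>\<sigma>\<close> kills, which gives both claims about
      \<open>\<beta> x\<close>.\<close>
    have k: "\<beta> x \<ominus>\<^bsub>L\<^esub> t x \<in> K"
      using \<rho>_eq[OF bx tL[OF x]] \<beta>(2)[OF x] by simp
    have "(\<beta> x \<ominus>\<^bsub>L\<^esub> t x) \<oplus>\<^bsub>L\<^esub> t x = \<beta> x"
      using bx tL[OF x] by (simp add: a_minus_def L.M.a_assoc L.M.l_neg)
    moreover have "\<sigma> (\<beta> x) = \<sigma> (t x)"
      using \<sigma>_minus[OF bx tL[OF x]] k mod_homD(1)[OF \<sigma> tL[OF x]] by (simp add: K_def mod_ker_def)
    ultimately show ?thesis
      using T'(3)[of "\<beta> x \<ominus>\<^bsub>L\<^esub> t x" "t x"] k t[OF x] by (simp add: K_def)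
  qed
  with \<beta>(1) show ?thesis by blast
qed

section \<open>Decomposing maps into a submodule through its cyclic submodules\<close>

text \<open>The codiagonal map from the direct power to \<open>M\<close>. The sum runs over the
  support because \<open>finsum\<close> over an infinite set is zero by convention.\<close>

definition direct_power_sum :: "('a, 'b, 'm) module_scheme \<Rightarrow> 'i set \<Rightarrow> ('i \<Rightarrow> 'b) \<Rightarrow> 'b"
  where "direct_power_sum M \<Lambda> v = finsum M v {i \<in> \<Lambda>. v i \<noteq> \<zero>\<^bsub>M\<^esub>}"

context left_module
begin

text \<open>Terms outside the support vanish. Families with different supports can thus be summed
  over one common finite set.\<close>

lemma direct_power_sum_superset:
  assumes "v \<in> carrier (direct_power M \<Lambda>)" "finite A" "A \<subseteq> \<Lambda>" "{i \<in> \<Lambda>. v i \<noteq> \<zero>\<^bsub>M\<^esub>} \<subseteq> A"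
  shows "direct_power_sum M \<Lambda> v = finsum M v A"
  unfolding direct_power_sum_def using assms
  by (intro M.add.finprod_mono_neutral_cong_left) (auto simp: direct_power_def)

lemma smult_finsum:
  assumes "r \<in> carrier R" "v \<in> A \<rightarrow> carrier M"
  shows "r \<odot>\<^bsub>M\<^esub> finsum M v A = finsum M (\<lambda>i. r \<odot>\<^bsub>M\<^esub> v i) A"
  using assms(2)
proof (induction A rule: infinite_finite_induct)
  case (insert a A)
  then have "finsum M v A \<in> carrier M" by (intro M.finsum_closed) auto
  moreover have "(\<lambda>i. r \<odot>\<^bsub>M\<^esub> v i) \<in> A \<rightarrow> carrier M"
    using insert.prems assms(1) by auto
  ultimately show ?case
    using insert assms(1) by (simp add: smult_r_distr)
qed (simp_all add: smult_zero_right assms(1))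

lemma direct_power_sum_hom:
  "direct_power_sum M \<Lambda> \<in> mod_hom R (direct_power M \<Lambda>) M"
proof (rule mod_homI)
  fix v assume "v \<in> carrier (direct_power M \<Lambda>)"
  then show "direct_power_sum M \<Lambda> v \<in> carrier M"
    unfolding direct_power_sum_def by (intro M.finsum_closed) (auto simp: direct_power_def)
next
  fix v w assume vw: "v \<in> carrier (direct_power M \<Lambda>)" "w \<in> carrier (direct_power M \<Lambda>)"
  interpret P: left_module R "direct_power M \<Lambda>"
    by (rule left_module_direct_power) unfold_locales
  let ?u = "v \<oplus>\<^bsub>direct_power M \<Lambda>\<^esub> w"
  let ?A = "{i \<in> \<Lambda>. v i \<noteq> \<zero>\<^bsub>M\<^esub>} \<union> {i \<in> \<Lambda>. w i \<noteq> \<zero>\<^bsub>M\<^esub>}"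
  have A: "finite ?A" "?A \<subseteq> \<Lambda>" using vw by (auto simp: direct_power_def)
  have u: "?u i = v i \<oplus>\<^bsub>M\<^esub> w i" if "i \<in> \<Lambda>" for i
    using that by (simp add: direct_power_def)
  have car: "v \<in> ?A \<rightarrow> carrier M" "w \<in> ?A \<rightarrow> carrier M"
    using vw by (auto simp: direct_power_def)
  have "direct_power_sum M \<Lambda> ?u = finsum M ?u ?A"
    using A u vw by (intro direct_power_sum_superset) auto
  also have "\<dots> = finsum M (\<lambda>i. v i \<oplus>\<^bsub>M\<^esub> w i) ?A"
    using car u by (intro M.finsum_cong') auto
  also have "\<dots> = finsum M v ?A \<oplus>\<^bsub>M\<^esub> finsum M w ?A"
    using car by (rule M.finsum_addf)
  also have "\<dots> = direct_power_sum M \<Lambda> v \<oplus>\<^bsub>M\<^esub> direct_power_sum M \<Lambda> w"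
    using vw A by (simp add: direct_power_sum_superset[of _ _ ?A])
  finally show "direct_power_sum M \<Lambda> ?u = direct_power_sum M \<Lambda> v \<oplus>\<^bsub>M\<^esub> direct_power_sum M \<Lambda> w" .
next
  fix r v assume rv: "r \<in> carrier R" "v \<in> carrier (direct_power M \<Lambda>)"
  interpret P: left_module R "direct_power M \<Lambda>"
    by (rule left_module_direct_power) unfold_locales
  let ?u = "r \<odot>\<^bsub>direct_power M \<Lambda>\<^esub> v"
  let ?A = "{i \<in> \<Lambda>. v i \<noteq> \<zero>\<^bsub>M\<^esub>}"
  have A: "finite ?A" "?A \<subseteq> \<Lambda>" using rv by (auto simp: direct_power_def)
  have u: "?u i = r \<odot>\<^bsub>M\<^esub> v i" if "i \<in> \<Lambda>" for i
    using that by (simp add: direct_power_def)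
  have car: "v \<in> ?A \<rightarrow> carrier M"
    using rv by (auto simp: direct_power_def)
  have "direct_power_sum M \<Lambda> ?u = finsum M ?u ?A"
    using A u rv by (intro direct_power_sum_superset) (auto simp: smult_zero_right)
  also have "\<dots> = finsum M (\<lambda>i. r \<odot>\<^bsub>M\<^esub> v i) ?A"
    using car u rv by (intro M.finsum_cong') auto
  finally show "direct_power_sum M \<Lambda> ?u = r \<odot>\<^bsub>M\<^esub> direct_power_sum M \<Lambda> v"
    using smult_finsum[OF rv(1) car] by (simp add: direct_power_sum_def)
qed

lemma finsum_mem_submodule:
  assumes H: "submodule H R M" and v: "\<And>i. i \<in> A \<Longrightarrow> v i \<in> H"
  shows "finsum M v A \<in> H"
  using v
proof (induction A rule: infinite_finite_induct)
  case (insert a A)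
  then have "v \<in> A \<rightarrow> carrier M" "v a \<in> carrier M" using submoduleD(1)[OF H] by auto
  with insert show ?case using submoduleD(3)[OF H] by simp
qed (simp_all add: submoduleD(2)[OF H])

text \<open>
  Lifting \<open>f\<close> through \<open>\<Oplus>\<^bsub>n\<in>N\<^esub> Rn \<rightarrow> N\<close> writes it as a pointwise finite sum of maps \<open>M \<rightarrow> Rn\<close>.
\<close>

lemma hom_into_submodule_via_cyclics:
  assumes proj: "power_projective R M" and N: "submodule N R M" and P: "submodule P R M"
    and f: "f \<in> mod_hom R M (M\<lparr>carrier := N\<rparr>)" and x: "x \<in> carrier M"
    and P_cyc: "\<And>n g. n \<in> N \<Longrightarrow> g \<in> mod_hom R M (M\<lparr>carrier := cyclic_submodule R M n\<rparr>) \<Longrightarrow> g x \<in> P"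
  shows "f x \<in> P"
proof -
  have M: "left_module R M" by unfold_locales
  interpret D: left_module R "direct_power M N"
    by (rule left_module_direct_power[OF M])
  note N' = submoduleD[OF N]
  note cyc = submodule_cyclic[OF N'(1)]
  have f': "f \<in> mod_hom R M M" "f ` carrier M \<subseteq> N"
    using mod_hom_restrict_codomain[of N M f R M] f N'(1) by auto
  \<comment> \<open>A copy of the direct sum of all \<open>Rn\<close> inside the direct power of
    \<open>M\<close> indexed by the elements of \<open>N\<close>.\<close>
  define T where "T = {v \<in> carrier (direct_power M N). \<forall>n\<in>N. v n \<in> cyclic_submodule R M n}"
  have T: "submodule T R (direct_power M N)"
    unfolding D.submodule_iff
  proof (intro conjI ballI)
    show "\<zero>\<^bsub>direct_power M N\<^esub> \<in> T"
      using D.M.zero_closed submoduleD(2)[OF cyc] by (simp add: T_def) (simp add: direct_power_def)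
  next
    fix v w assume "v \<in> T" "w \<in> T"
    then show "v \<oplus>\<^bsub>direct_power M N\<^esub> w \<in> T"
      using D.M.a_closed[of v w] submoduleD(3)[OF cyc] by (simp add: T_def) (simp add: direct_power_def)
  next
    fix r v assume "r \<in> carrier R" "v \<in> T"
    then show "r \<odot>\<^bsub>direct_power M N\<^esub> v \<in> T"
      using D.smult_closed[of r v] submoduleD(4)[OF cyc] by (simp add: T_def) (simp add: direct_power_def)
  qed (auto simp: T_def)
  have "n \<in> direct_power_sum M N ` T" if n: "n \<in> N" for n
  proof
    \<comment> \<open>The family with the single entry \<open>n\<close> at index \<open>n\<close>;
      its sum is \<open>n\<close>.\<close>
    define v where "v = (\<lambda>i\<in>N. if i = n then n else \<zero>\<^bsub>M\<^esub>)"
    have sup: "{i \<in> N. v i \<noteq> \<zero>\<^bsub>M\<^esub>} \<subseteq> {n}" by (auto simp: v_def)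
    then have "finite {i \<in> N. v i \<noteq> \<zero>\<^bsub>M\<^esub>}" by (rule finite_subset) simp
    moreover have "v \<in> N \<rightarrow>\<^sub>E carrier M" using N'(1) by (simp add: v_def)
    ultimately have v: "v \<in> carrier (direct_power M N)" by (simp add: direct_power_def)
    then show "v \<in> T"
      using submoduleD(2)[OF cyc] cyclic_submodule_self[OF N'(1)] by (auto simp: T_def v_def)
    show "n = direct_power_sum M N v"
      using direct_power_sum_superset[OF v, of "{n}"] sup n N'(1) by (simp add: v_def)
  qed
  then have "f ` carrier M \<subseteq> direct_power_sum M N ` T" using f'(2) by auto
  from rel_projective_submodule_lift[OF D.left_module_axioms M M
      power_projective_any_index[OF M proj] T direct_power_sum_hom f'(1) this]
  obtain \<beta> where \<beta>: "\<beta> \<in> mod_hom R M (direct_power M N)"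
    and \<beta>T: "\<And>x. x \<in> carrier M \<Longrightarrow> \<beta> x \<in> T"
    and \<beta>f: "\<And>x. x \<in> carrier M \<Longrightarrow> direct_power_sum M N (\<beta> x) = f x"
    by blast
  \<comment> \<open>Each coordinate of the lift is a homomorphism from \<open>M\<close> to
    \<open>Rn\<close>, so the hypothesis on such maps applies to it.\<close>
  have "\<beta> x n \<in> P" if n: "n \<in> N" for n
  proof (rule P_cyc[OF n, of "\<lambda>y. \<beta> y n"], rule mod_homI)
    fix y z assume yz: "y \<in> carrier M" "z \<in> carrier M"
    show "\<beta> (y \<oplus>\<^bsub>M\<^esub> z) n = \<beta> y n \<oplus>\<^bsub>M\<lparr>carrier := cyclic_submodule R M n\<rparr>\<^esub> \<beta> z n"
      using n by (simp add: mod_homD(2)[OF \<beta> yz]) (simp add: direct_power_def)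
  next
    fix r y assume ry: "r \<in> carrier R" "y \<in> carrier M"
    show "\<beta> (r \<odot>\<^bsub>M\<^esub> y) n = r \<odot>\<^bsub>M\<lparr>carrier := cyclic_submodule R M n\<rparr>\<^esub> \<beta> y n"
      using n by (simp add: mod_homD(3)[OF \<beta> ry]) (simp add: direct_power_def)
  qed (use \<beta>T n in \<open>auto simp: T_def\<close>)
  then show ?thesis
    using finsum_mem_submodule[OF P, of "{n \<in> N. \<beta> x n \<noteq> \<zero>\<^bsub>M\<^esub>}" "\<beta> x"] \<beta>f[OF x]
    by (simp add: direct_power_sum_def)
qed

end

section \<open>Finite uniform dimension and chain conditions\<close>

context left_module
begin

section \<open>Sums of submodules\<close>

lemma submodule_setsum:
  assumes A: "submodule A R M" and B: "submodule B R M"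
  shows "submodule {a \<oplus>\<^bsub>M\<^esub> b | a b. a \<in> A \<and> b \<in> B} R M"
  unfolding submodule_iff
proof (intro conjI ballI)
  note A' = submoduleD[OF A] and B' = submoduleD[OF B]
  let ?S = "{a \<oplus>\<^bsub>M\<^esub> b | a b. a \<in> A \<and> b \<in> B}"
  show "?S \<subseteq> carrier M" using A'(1) B'(1) by auto
  show "\<zero>\<^bsub>M\<^esub> \<in> ?S"
    using A'(2) B'(2) by (intro CollectI exI[of _ "\<zero>\<^bsub>M\<^esub>"]) simp
  show "x \<oplus>\<^bsub>M\<^esub> y \<in> ?S" if "x \<in> ?S" "y \<in> ?S" for x y
  proof -
    from that obtain a b a' b' where *: "a \<in> A" "b \<in> B" "a' \<in> A" "b' \<in> B"
      "x = a \<oplus>\<^bsub>M\<^esub> b" "y = a' \<oplus>\<^bsub>M\<^esub> b'" by blast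
    then have "x \<oplus>\<^bsub>M\<^esub> y = (a \<oplus>\<^bsub>M\<^esub> a') \<oplus>\<^bsub>M\<^esub> (b \<oplus>\<^bsub>M\<^esub> b')"
      using A'(1) B'(1) by (simp add: M.a_ac)
    with * A'(3) B'(3) show ?thesis by blast
  qed
  show "r \<odot>\<^bsub>M\<^esub> x \<in> ?S" if "r \<in> carrier R" "x \<in> ?S" for r x
  proof -
    from that obtain a b where *: "a \<in> A" "b \<in> B" "x = a \<oplus>\<^bsub>M\<^esub> b" by blast
    then have "r \<odot>\<^bsub>M\<^esub> x = r \<odot>\<^bsub>M\<^esub> a \<oplus>\<^bsub>M\<^esub> r \<odot>\<^bsub>M\<^esub> b"
      using A'(1) B'(1) that by (simp add: smult_r_distr)
    with * A'(4) B'(4) that show ?thesis by blast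
  qed
qed

lemma subset_setsum:
  assumes "submodule A R M" "submodule B R M"
  shows "A \<subseteq> {a \<oplus>\<^bsub>M\<^esub> b | a b. a \<in> A \<and> b \<in> B}" "B \<subseteq> {a \<oplus>\<^bsub>M\<^esub> b | a b. a \<in> A \<and> b \<in> B}"
proof -
  note A = submoduleD(1,2)[OF assms(1)] and B = submoduleD(1,2)[OF assms(2)]
  have "x = x \<oplus>\<^bsub>M\<^esub> \<zero>\<^bsub>M\<^esub>" "x = \<zero>\<^bsub>M\<^esub> \<oplus>\<^bsub>M\<^esub> x" if "x \<in> A \<union> B" for x
    using that A(1) B(1) by auto
  then show "A \<subseteq> {a \<oplus>\<^bsub>M\<^esub> b | a b. a \<in> A \<and> b \<in> B}" "B \<subseteq> {a \<oplus>\<^bsub>M\<^esub> b | a b. a \<in> A \<and> b \<in> B}"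
    using A(2) B(2) by blast+
qed

lemma sum_submodules_empty: "sum_submodules R M {} = {\<zero>\<^bsub>M\<^esub>}"
proof
  show "sum_submodules R M {} \<subseteq> {\<zero>\<^bsub>M\<^esub>}"
    unfolding sum_submodules_def by (rule hull_minimal) (simp_all add: submodule_zero)
  show "{\<zero>\<^bsub>M\<^esub>} \<subseteq> sum_submodules R M {}"
    using submoduleD(2)[OF submodule_sum_submodules[of "{}"]] by simp
qed

text \<open>The right-hand side is a submodule containing \<open>A\<close> and all members of
  \<open>F\<close>, hence it contains the submodule they generate.\<close>

lemma sum_submodules_insert:
  assumes A: "submodule A R M" and F: "\<And>H. H \<in> F \<Longrightarrow> submodule H R M"
  shows "sum_submodules R M (insert A F) \<subseteq> {a \<oplus>\<^bsub>M\<^esub> b | a b. a \<in> A \<and> b \<in> sum_submodules R M F}"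
    (is "_ \<subseteq> ?S")
  unfolding sum_submodules_def[of _ _ "insert A F"]
proof (rule hull_minimal)
  note sum = submodule_sum_submodules[of F, OF F]
  show "submodule ?S R M" by (rule submodule_setsum[OF A sum])
  have "\<Union>F \<subseteq> sum_submodules R M F" unfolding sum_submodules_def by (rule hull_subset)
  then show "\<Union>(insert A F) \<subseteq> ?S"
    using subset_setsum[OF A sum] by auto
qed

lemma sum_submodules_mono: "F \<subseteq> G \<Longrightarrow> sum_submodules R M F \<subseteq> sum_submodules R M G"
  unfolding sum_submodules_def by (intro hull_mono) auto

lemma member_sum_submodules: "H \<in> F \<Longrightarrow> H \<subseteq> sum_submodules R M F"
  unfolding sum_submodules_def by (intro subset_trans[OF _ hull_subset]) auto

text \<open>\<open>Ru\<close> and \<open>Y \<inter> U\<close> are nonzero submodules of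
  \<open>U\<close>, so uniformity gives them a nonzero common element, which is a multiple of
  \<open>u\<close>.\<close>

lemma uniform_submodule_multiple:
  assumes U: "uniform_submodule R M U" and Y: "submodule Y R M" "Y \<inter> U \<noteq> {\<zero>\<^bsub>M\<^esub>}"
    and u: "u \<in> U" "u \<noteq> \<zero>\<^bsub>M\<^esub>"
  shows "\<exists>s\<in>carrier R. s \<odot>\<^bsub>M\<^esub> u \<in> Y \<and> s \<odot>\<^bsub>M\<^esub> u \<noteq> \<zero>\<^bsub>M\<^esub>"
proof -
  have U': "submodule U R M" using U by (simp add: uniform_submodule_def)
  note uM = submoduleD(1)[OF U' u(1)]
  note C = submodule_cyclic[OF uM]
  have YU: "submodule (Y \<inter> U) R M" using Y(1) U' by (rule submodule_Int)
  have "cyclic_submodule R M u \<noteq> {\<zero>\<^bsub>M\<^esub>}"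
    using cyclic_submodule_self[OF uM] u(2) by auto
  then have "cyclic_submodule R M u \<inter> (Y \<inter> U) \<noteq> {\<zero>\<^bsub>M\<^esub>}"
    using U C YU Y(2) cyclic_submodule_subset[OF U' u(1)] unfolding uniform_submodule_def by blast
  moreover have "\<zero>\<^bsub>M\<^esub> \<in> cyclic_submodule R M u \<inter> (Y \<inter> U)"
    using submoduleD(2)[OF C] submoduleD(2)[OF YU] by blast
  ultimately obtain y where "y \<in> cyclic_submodule R M u" "y \<in> Y" "y \<noteq> \<zero>\<^bsub>M\<^esub>" by blast
  then show ?thesis by (auto simp: cyclic_submodule_def)
qed

text \<open>A submodule meeting every summand of a direct sum of uniform submodules meets every
  nonzero submodule of that sum. By induction on the number of summands: write
  \<open>x = u \<oplus> y\<close>, multiply so that the \<open>y\<close> part lands in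
  \<open>Y\<close>, then multiply again for the \<open>u\<close> part.\<close>

lemma sum_uniform_multiple:
  assumes U: "\<And>i. i \<in> I \<Longrightarrow> uniform_submodule R M (U i)"
    and ind: "independent_submodules R M I U"
    and Y: "submodule Y R M" "\<And>i. i \<in> I \<Longrightarrow> Y \<inter> U i \<noteq> {\<zero>\<^bsub>M\<^esub>}"
    and F: "finite F" "F \<subseteq> I" and x: "x \<in> sum_submodules R M (U ` F)" "x \<noteq> \<zero>\<^bsub>M\<^esub>"
  shows "\<exists>r\<in>carrier R. r \<odot>\<^bsub>M\<^esub> x \<in> Y \<and> r \<odot>\<^bsub>M\<^esub> x \<noteq> \<zero>\<^bsub>M\<^esub>"
  using F x
proof (induction F arbitrary: x rule: finite_induct)
  case empty
  then show ?case by (simp add: sum_submodules_empty)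
next
  case (insert i F)
  have U': "submodule (U j) R M" if "j \<in> I" for j
    using U[OF that] by (simp add: uniform_submodule_def)
  have i: "i \<in> I" and FI: "F \<subseteq> I" using insert.prems by auto
  note Y' = submoduleD[OF Y(1)] and Ui = submoduleD[OF U'[OF i]]
  let ?X = "sum_submodules R M (U ` F)"
  have X: "submodule ?X R M" using U' FI by (intro submodule_sum_submodules) auto
  note X' = submoduleD[OF X]
  have "?X \<subseteq> sum_submodules R M (U ` (I - {i}))"
    using insert.hyps FI by (intro sum_submodules_mono) auto
  then have disj: "U i \<inter> ?X \<subseteq> {\<zero>\<^bsub>M\<^esub>}"
    using ind i unfolding independent_submodules_def by blast
  have "x \<in> {a \<oplus>\<^bsub>M\<^esub> b | a b. a \<in> U i \<and> b \<in> ?X}"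
    using sum_submodules_insert[OF U'[OF i], of "U ` F"] U' FI insert.prems by auto
  then obtain u y where u: "u \<in> U i" and y: "y \<in> ?X" and x: "x = u \<oplus>\<^bsub>M\<^esub> y" by blast
  note uM = Ui(1)[OF u] and yM = X'(1)[OF y]
  show ?case
  proof (cases "y = \<zero>\<^bsub>M\<^esub>")
    case True
    then have "x = u" using x uM by simp
    then show ?thesis
      using uniform_submodule_multiple[OF U[OF i] Y(1) Y(2)[OF i]] u insert.prems by blast
  next
    case False
    then obtain r where r: "r \<in> carrier R" "r \<odot>\<^bsub>M\<^esub> y \<in> Y" "r \<odot>\<^bsub>M\<^esub> y \<noteq> \<zero>\<^bsub>M\<^esub>"
      using insert.IH[OF FI y] by blast
    show ?thesis
    proof (cases "r \<odot>\<^bsub>M\<^esub> u = \<zero>\<^bsub>M\<^esub>")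
      case True
      then have "r \<odot>\<^bsub>M\<^esub> x = r \<odot>\<^bsub>M\<^esub> y" using x uM yM r by (simp add: smult_r_distr)
      with r show ?thesis by metis
    next
      case False
      obtain s where s: "s \<in> carrier R" "s \<odot>\<^bsub>M\<^esub> (r \<odot>\<^bsub>M\<^esub> u) \<in> Y" "s \<odot>\<^bsub>M\<^esub> (r \<odot>\<^bsub>M\<^esub> u) \<noteq> \<zero>\<^bsub>M\<^esub>"
        using uniform_submodule_multiple[OF U[OF i] Y(1) Y(2)[OF i] Ui(4)[OF r(1) u] False] by blast
      let ?u = "s \<odot>\<^bsub>M\<^esub> (r \<odot>\<^bsub>M\<^esub> u)" and ?y = "s \<odot>\<^bsub>M\<^esub> (r \<odot>\<^bsub>M\<^esub> y)"
      have mem: "?u \<in> U i" "?y \<in> ?X" using u y r s Ui(4) X'(4) by auto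
      have sx: "(s \<otimes>\<^bsub>R\<^esub> r) \<odot>\<^bsub>M\<^esub> x = ?u \<oplus>\<^bsub>M\<^esub> ?y"
        using x uM yM r s by (simp add: smult_r_distr smult_assoc)
      \<comment> \<open>Independence rules out cancellation: otherwise the nonzero \<open>?u\<close>
        would lie both in \<open>U i\<close> and in the sum of the other summands.\<close>
      have "?u \<oplus>\<^bsub>M\<^esub> ?y \<noteq> \<zero>\<^bsub>M\<^esub>"
      proof
        assume "?u \<oplus>\<^bsub>M\<^esub> ?y = \<zero>\<^bsub>M\<^esub>"
        then have "?u = \<ominus>\<^bsub>M\<^esub> ?y" using mem Ui(1) X'(1) by (metis M.minus_equality)
        then have "?u \<in> ?X" using X'(5) mem by simp
        with mem disj s show False by blast
      qed
      moreover have "?u \<oplus>\<^bsub>M\<^esub> ?y \<in> Y" using Y'(3,4) r s by blast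
      ultimately show ?thesis using sx r s by (metis R.m_closed)
    qed
  qed
qed

text \<open>
  Exchange argument: \<open>W k\<close> is independent of some \<open>k\<close> of the given uniform submodules.
\<close>

lemma finite_uniform_dimension_no_chain:
  assumes fud: "finite_uniform_dimension R M"
    and W: "\<And>k. submodule (W k) R M" "\<And>k. W (Suc k) \<subseteq> W k"
    and V: "\<And>k. submodule (V k) R M" "\<And>k. V k \<subseteq> W k" "\<And>k. V k \<noteq> {\<zero>\<^bsub>M\<^esub>}"
      "\<And>k. V k \<inter> W (Suc k) \<subseteq> {\<zero>\<^bsub>M\<^esub>}"
  shows False
proof -
  obtain n U where U: "\<And>i. i \<in> {..<n} \<Longrightarrow> uniform_submodule R M (U i)"
    and ind: "independent_submodules R M {..<n::nat} U"
    and ess: "essential_submodule R M (sum_submodules R M (U ` {..<n}))"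
    using fud unfolding finite_uniform_dimension_def by blast
  have U': "submodule (U j) R M" "U j \<noteq> {\<zero>\<^bsub>M\<^esub>}" if "j \<in> {..<n}" for j
    using U[OF that] by (simp_all add: uniform_submodule_def)
  have "\<exists>I\<subseteq>{..<n}. card I = k \<and> W k \<inter> sum_submodules R M (U ` I) \<subseteq> {\<zero>\<^bsub>M\<^esub>}" for k
  proof (induction k)
    case 0
    show ?case by (intro exI[of _ "{}"]) (simp add: sum_submodules_empty)
  next
    case (Suc k)
    then obtain I where I: "I \<subseteq> {..<n}" "card I = k"
      and disj: "W k \<inter> sum_submodules R M (U ` I) \<subseteq> {\<zero>\<^bsub>M\<^esub>}" by blast
    let ?X = "sum_submodules R M (U ` I)"
    have X: "submodule ?X R M" using U' I by (intro submodule_sum_submodules) auto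
    note X' = submoduleD[OF X] and Wk = submoduleD[OF W(1)[of k]]
      and Wk1 = submoduleD[OF W(1)[of "Suc k"]] and Vk = submoduleD[OF V(1)[of k]]
    \<comment> \<open>If no \<open>j\<close> could be added, \<open>Y = W (Suc k) + ?X\<close> would
      meet every \<open>U j\<close> nontrivially, and would then contain a nonzero multiple of an
      element of \<open>V k\<close>.\<close>
    have "\<exists>j\<in>{..<n} - I. W (Suc k) \<inter> sum_submodules R M (U ` insert j I) \<subseteq> {\<zero>\<^bsub>M\<^esub>}"
    proof (rule ccontr)
      assume neg: "\<not> ?thesis"
      define Y where "Y = {a \<oplus>\<^bsub>M\<^esub> b | a b. a \<in> W (Suc k) \<and> b \<in> ?X}"
      have Y: "submodule Y R M" unfolding Y_def by (rule submodule_setsum[OF W(1) X])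
      have sub: "W (Suc k) \<subseteq> Y" "?X \<subseteq> Y"
        unfolding Y_def using subset_setsum[OF W(1) X] by auto
      have YU: "Y \<inter> U j \<noteq> {\<zero>\<^bsub>M\<^esub>}" if j: "j \<in> {..<n}" for j
      proof (cases "j \<in> I")
        case True
        then have "U j \<subseteq> Y" using member_sum_submodules[of "U j" "U ` I"] sub by blast
        then show ?thesis using U'(2)[OF j] by blast
      next
        case False
        then obtain w where w: "w \<in> W (Suc k)" "w \<in> sum_submodules R M (U ` insert j I)" "w \<noteq> \<zero>\<^bsub>M\<^esub>"
          using neg j by blast
        have "w \<in> {a \<oplus>\<^bsub>M\<^esub> b | a b. a \<in> U j \<and> b \<in> ?X}"
          using sum_submodules_insert[OF U'(1)[OF j], of "U ` I"] U'(1) I w(2) by auto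
        then obtain u x where u: "u \<in> U j" and x: "x \<in> ?X" and wux: "w = u \<oplus>\<^bsub>M\<^esub> x" by blast
        note uM = submoduleD(1)[OF U'(1)[OF j] u]
        \<comment> \<open>A nonzero element of \<open>W (Suc k)\<close> in \<open>U j + ?X\<close>
          has its \<open>U j\<close> component in \<open>Y\<close>. That component is nonzero
          because \<open>W k\<close> meets \<open>?X\<close> trivially.\<close>
        have "u = w \<ominus>\<^bsub>M\<^esub> x"
          using wux uM X'(1)[OF x] by (simp add: a_minus_def M.a_assoc M.r_neg)
        then have "u \<in> Y" using submoduleD(6)[OF Y] sub w(1) x by blast
        moreover have "u \<noteq> \<zero>\<^bsub>M\<^esub>"
        proof
          assume "u = \<zero>\<^bsub>M\<^esub>"
          then have "w = x" using wux X'(1)[OF x] by simp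
          then show False using disj W(2) w x by blast
        qed
        ultimately show ?thesis using u by blast
      qed
      have "V k \<inter> sum_submodules R M (U ` {..<n}) \<noteq> {\<zero>\<^bsub>M\<^esub>}"
        using ess V(1,3) unfolding essential_submodule_def by blast
      moreover have "\<zero>\<^bsub>M\<^esub> \<in> V k \<inter> sum_submodules R M (U ` {..<n})"
        using Vk(2) submoduleD(2) ess unfolding essential_submodule_def by blast
      ultimately obtain v where v: "v \<in> V k" "v \<in> sum_submodules R M (U ` {..<n})" "v \<noteq> \<zero>\<^bsub>M\<^esub>"
        by blast
      obtain r where r: "r \<in> carrier R" "r \<odot>\<^bsub>M\<^esub> v \<in> Y" "r \<odot>\<^bsub>M\<^esub> v \<noteq> \<zero>\<^bsub>M\<^esub>"
        using sum_uniform_multiple[OF U ind Y YU finite_lessThan subset_refl v(2,3)] by blast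
      then obtain w x where w: "w \<in> W (Suc k)" and x: "x \<in> ?X" and rv: "r \<odot>\<^bsub>M\<^esub> v = w \<oplus>\<^bsub>M\<^esub> x"
        unfolding Y_def by blast
      have rvV: "r \<odot>\<^bsub>M\<^esub> v \<in> V k" using Vk(4) r v by blast
      \<comment> \<open>Both \<open>r \<odot> v\<close> and \<open>w\<close> lie in
        \<open>W k\<close>, so \<open>x\<close> lies in \<open>W k \<inter> ?X\<close> and vanishes.
        Then \<open>r \<odot> v\<close> is a nonzero element of
        \<open>V k \<inter> W (Suc k)\<close>.\<close>
      have "x = r \<odot>\<^bsub>M\<^esub> v \<ominus>\<^bsub>M\<^esub> w"
        using Wk1(1)[OF w] X'(1)[OF x] unfolding rv
        by (metis M.a_assoc M.a_comm M.a_inv_closed M.r_neg M.r_zero a_minus_def)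
      moreover have "r \<odot>\<^bsub>M\<^esub> v \<in> W k" "w \<in> W k" using rvV V(2) W(2) w by auto
      ultimately have "x \<in> W k" using Wk(6) by blast
      then have "x = \<zero>\<^bsub>M\<^esub>" using disj x by blast
      then have "r \<odot>\<^bsub>M\<^esub> v = w" using rv Wk1(1)[OF w] by simp
      then show False using V(4) w rvV r(3) by blast
    qed
    then obtain j where "j \<in> {..<n} - I" "W (Suc k) \<inter> sum_submodules R M (U ` insert j I) \<subseteq> {\<zero>\<^bsub>M\<^esub>}"
      by blast
    moreover have "finite I" using I(1) by (rule finite_subset) simp
    ultimately show ?case using I by (intro exI[of _ "insert j I"]) auto
  qed
  \<comment> \<open>At stage \<open>Suc n\<close> more summands would be selected than
    exist.\<close>
  then obtain I where "I \<subseteq> {..<n}" "card I = Suc n" by blast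
  then show False using card_mono[of "{..<n}" I] by simp
qed

end

lemma ascending_chain_condition_maximal:
  assumes acc: "ascending_chain_condition \<C>" and D: "\<D> \<subseteq> \<C>" "\<D> \<noteq> {}"
  shows "\<exists>A\<in>\<D>. \<forall>B\<in>\<D>. A \<subseteq> B \<longrightarrow> B = A"
proof (rule ccontr)
  assume neg: "\<not> ?thesis"
  have "\<exists>C. \<forall>n. C n \<in> \<D> \<and> C n \<subset> C (Suc n)"
  proof (rule dependent_nat_choice)
    show "\<exists>A. A \<in> \<D>" using D(2) by blast
    show "\<exists>B. B \<in> \<D> \<and> A \<subset> B" if "A \<in> \<D>" for A
      using neg that by blast
  qed
  then obtain C where C: "\<And>n. C n \<in> \<D>" "\<And>n. C n \<subset> C (Suc n)" by blast
  have "(\<forall>n. C n \<in> \<C>) \<and> (\<forall>n. C n \<subseteq> C (Suc n))"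
    using C D(1) by blast
  then obtain m where "\<forall>n\<ge>m. C n = C m"
    using acc unfolding ascending_chain_condition_def by blast
  then have "C (Suc m) = C m" by (meson le_SucI order_refl)
  with C(2)[of m] show False by simp
qed

section \<open>Nil semigroups of endomorphisms of a Goldie module\<close>

text \<open>The \<open>n\<close>-th term is the annihilator in \<open>M\<close> of
  \<open>J^n\<close>, that is, the set of elements killed by every product of \<open>n\<close>
  members of \<open>J\<close>.\<close>

primrec annihilator_chain ::
    "('a, 'b, 'm) module_scheme \<Rightarrow> ('b \<Rightarrow> 'b) set \<Rightarrow> nat \<Rightarrow> 'b set"
  where
    "annihilator_chain M J 0 = {\<zero>\<^bsub>M\<^esub>}"
  | "annihilator_chain M J (Suc n) = {x \<in> carrier M. \<forall>g\<in>J. g x \<in> annihilator_chain M J n}"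

context left_module
begin

lemma submodule_annihilator_chain:
  assumes J: "J \<subseteq> mod_End R M"
  shows "submodule (annihilator_chain M J n) R M"
proof (induction n)
  case 0
  show ?case by (simp add: submodule_zero)
next
  case (Suc n)
  have M: "left_module R M" by unfold_locales
  note K = submoduleD[OF Suc]
  have "g (x \<oplus>\<^bsub>M\<^esub> y) \<in> annihilator_chain M J n"
    if "g \<in> J" "x \<in> annihilator_chain M J (Suc n)" "y \<in> annihilator_chain M J (Suc n)" for g x y
    using that mod_homD(2)[of g R M M] J K(3) by auto
  moreover have "g (r \<odot>\<^bsub>M\<^esub> x) \<in> annihilator_chain M J n"
    if "g \<in> J" "r \<in> carrier R" "x \<in> annihilator_chain M J (Suc n)" for g r x
    using that mod_homD(3)[of g R M M] J K(4) by auto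
  moreover have "g \<zero>\<^bsub>M\<^esub> \<in> annihilator_chain M J n" if "g \<in> J" for g
    using mod_hom_zero[OF M M, of g] that J K(2) by auto
  ultimately show ?case unfolding submodule_iff by auto
qed

lemma annihilator_chain_mono:
  assumes J: "J \<subseteq> mod_End R M"
  shows "annihilator_chain M J n \<subseteq> annihilator_chain M J (Suc n)"
proof (induction n)
  case 0
  have M: "left_module R M" by unfold_locales
  then show ?case using mod_hom_zero[OF M M] J by auto
next
  case (Suc n)
  then show ?case by auto
qed

text \<open>Makes the chain condition of a Goldie module applicable. The annihilating set starts as
  \<open>{id}\<close> and each step composes its members with the elements of \<open>J\<close> on
  the right.\<close>

lemma annihilator_chain_annihilator:
  assumes J: "J \<subseteq> mod_End R M"
  shows "annihilator_chain M J n \<in> annihilator_submodules R M"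
proof -
  have "\<exists>X\<subseteq>mod_End R M. \<forall>x\<in>carrier M. x \<in> annihilator_chain M J n \<longleftrightarrow> (\<forall>w\<in>X. w x = \<zero>\<^bsub>M\<^esub>)"
  proof (induction n)
    case 0
    show ?case by (intro exI[of _ "{id}"]) (simp add: mod_hom_id)
  next
    case (Suc n)
    then obtain X where X: "X \<subseteq> mod_End R M"
      "\<And>x. x \<in> carrier M \<Longrightarrow> x \<in> annihilator_chain M J n \<longleftrightarrow> (\<forall>w\<in>X. w x = \<zero>\<^bsub>M\<^esub>)" by blast
    let ?X = "\<Union>g\<in>J. (\<lambda>w. w \<circ> g) ` X"
    show ?case
    proof (intro exI conjI ballI)
      show "?X \<subseteq> mod_End R M"
        using X(1) J mod_hom_comp by blast
    next
      fix x assume x: "x \<in> carrier M"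
      have "g x \<in> annihilator_chain M J n \<longleftrightarrow> (\<forall>w\<in>X. (w \<circ> g) x = \<zero>\<^bsub>M\<^esub>)" if "g \<in> J" for g
        using X(2)[of "g x"] J that mod_homD(1)[of g R M M x] x by auto
      then show "x \<in> annihilator_chain M J (Suc n) \<longleftrightarrow> (\<forall>w\<in>?X. w x = \<zero>\<^bsub>M\<^esub>)"
        using x by auto
    qed
  qed
  then obtain X where X: "X \<subseteq> mod_End R M"
    "\<And>x. x \<in> carrier M \<Longrightarrow> x \<in> annihilator_chain M J n \<longleftrightarrow> (\<forall>w\<in>X. w x = \<zero>\<^bsub>M\<^esub>)" by blast
  then have "annihilator_chain M J n = carrier M \<inter> (\<Inter>f\<in>X. mod_ker M M f)"
    using submoduleD(1)[OF submodule_annihilator_chain[OF J]] by (auto simp: mod_ker_def)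
  with X(1) show ?thesis unfolding annihilator_submodules_def by blast
qed

text \<open>The chain condition on annihilators enters twice: it stabilises the annihilators of the
  powers of \<open>J\<close>, and it supplies the factors with maximal kernel.\<close>

theorem nil_semigroup_nilpotent:
  assumes Goldie: "Goldie_module R M" and J: "J \<subseteq> mod_End R M"
    and J_comp: "\<And>f g. f \<in> J \<Longrightarrow> g \<in> J \<Longrightarrow> f \<circ> g \<in> J"
    and nil: "\<And>f. f \<in> J \<Longrightarrow> nilpotent_endo M f"
  shows "\<exists>n. annihilator_chain M J n = carrier M"
proof (rule ccontr)
  assume neg: "\<not> ?thesis"
  have M: "left_module R M" by unfold_locales
  have acc: "ascending_chain_condition (annihilator_submodules R M)"
    and fud: "finite_uniform_dimension R M"
    using Goldie by (auto simp: Goldie_module_def)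
  have "(\<forall>n. annihilator_chain M J n \<in> annihilator_submodules R M) \<and>
      (\<forall>n. annihilator_chain M J n \<subseteq> annihilator_chain M J (Suc n))"
    using annihilator_chain_annihilator[OF J] annihilator_chain_mono[OF J] by blast
  then obtain n where n: "\<And>m. m \<ge> n \<Longrightarrow> annihilator_chain M J m = annihilator_chain M J n"
    using acc unfolding ascending_chain_condition_def by blast
  define K where "K = annihilator_chain M J n"
  note K_sub = submodule_annihilator_chain[OF J, of n, folded K_def]
  note K = submoduleD[OF K_sub]
  \<comment> \<open>By stability, \<open>M / K\<close> has no nonzero element killed by all of
    \<open>J\<close>. Hence every live map stays live after some further factor from
    \<open>J\<close>.\<close>
  have K_step: "x \<in> K" if "x \<in> carrier M" "\<And>g. g \<in> J \<Longrightarrow> g x \<in> K" for x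
  proof -
    have "x \<in> annihilator_chain M J (Suc n)" using that by (simp add: K_def)
    then show ?thesis using n[of "Suc n"] by (simp only: K_def le_SucI)
  qed
  define live where "live h \<longleftrightarrow> (\<exists>x\<in>carrier M. h x \<notin> K)" for h :: "'b \<Rightarrow> 'b"
  have J_End: "g \<in> mod_End R M" if "g \<in> J" for g using that J by blast
  note J_closed = mod_homD(1)[OF J_End]
  have choice: "\<exists>a\<in>J. live (a \<circ> h) \<and> (\<forall>b\<in>J. live (b \<circ> a \<circ> h) \<longrightarrow> mod_ker M M (b \<circ> a) = mod_ker M M a)"
    if h: "h \<in> mod_End R M" "live h" for h
  proof -
    let ?A = "{a \<in> J. live (a \<circ> h)}"
    obtain x where x: "x \<in> carrier M" "h x \<notin> K" using h(2) by (auto simp: live_def)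
    then obtain g where "g \<in> J" "g (h x) \<notin> K"
      using K_step mod_homD(1)[OF h(1)] by blast
    then have "?A \<noteq> {}" using x by (auto simp: live_def)
    moreover have "mod_ker M M a \<in> annihilator_submodules R M" if "a \<in> J" for a
      unfolding annihilator_submodules_def using J_End[OF that]
      by (intro CollectI exI[of _ "{a}"]) (auto simp: mod_ker_def)
    ultimately have "\<exists>B\<in>mod_ker M M ` ?A. \<forall>B'\<in>mod_ker M M ` ?A. B \<subseteq> B' \<longrightarrow> B' = B"
      by (intro ascending_chain_condition_maximal[OF acc]) auto
    then obtain a where a: "a \<in> ?A"
      "\<And>a'. a' \<in> ?A \<Longrightarrow> mod_ker M M a \<subseteq> mod_ker M M a' \<Longrightarrow> mod_ker M M a' = mod_ker M M a"
      unfolding bex_simps ball_simps by fast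
    have "mod_ker M M (b \<circ> a) = mod_ker M M a" if b: "b \<in> J" "live (b \<circ> a \<circ> h)" for b
    proof (rule a(2))
      \<comment> \<open>Since \<open>J\<close> is closed under composition,
        \<open>b \<circ> a\<close> competes with \<open>a\<close> for the maximal kernel; its kernel
        contains that of \<open>a\<close>, so the two agree.\<close>
      show "b \<circ> a \<in> ?A" using b a(1) J_comp by auto
      show "mod_ker M M a \<subseteq> mod_ker M M (b \<circ> a)"
        using mod_hom_zero[OF M M J_End[OF b(1)]] by (auto simp: mod_ker_def)
    qed
    then show ?thesis using a(1) by blast
  qed
  then obtain A where A: "\<And>h. h \<in> mod_End R M \<Longrightarrow> live h \<Longrightarrow> A h \<in> J \<and> live (A h \<circ> h) \<and>
      (\<forall>b\<in>J. live (b \<circ> A h \<circ> h) \<longrightarrow> mod_ker M M (b \<circ> A h) = mod_ker M M (A h))"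
    by metis
  define p where "p = rec_nat id (\<lambda>_ h. A h \<circ> h)"
  define a where "a i = A (p i)" for i
  have p_0: "p 0 = id" and p_Suc: "p (Suc i) = a i \<circ> p i" for i
    by (simp_all add: p_def a_def)
  have "live id"
    using neg K(1) by (auto simp: live_def K_def)
  have p: "p i \<in> mod_End R M \<and> live (p i)" for i
  proof (induction i)
    case 0
    show ?case unfolding p_0 using \<open>live id\<close> mod_hom_id by blast
  next
    case (Suc i)
    then show ?case
      using A[of "p i"] J_End mod_hom_comp unfolding p_Suc a_def by blast
  qed
  note p_closed = mod_homD(1)[OF conjunct1[OF p]]
  have a: "a i \<in> J" for i
    using A[of "p i"] p[of i] by (auto simp: a_def)
  note a_closed = J_closed[OF a]
  have a_max: "a i y = \<zero>\<^bsub>M\<^esub>"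
    if "b \<in> J" "x \<in> carrier M" "b (a i (p i x)) \<notin> K" "y \<in> carrier M" "b (a i y) = \<zero>\<^bsub>M\<^esub>" for b i x y
  proof -
    have "live (b \<circ> a i \<circ> p i)" using that(2,3) by (auto simp: live_def)
    then have "mod_ker M M (b \<circ> a i) = mod_ker M M (a i)"
      using A[of "p i"] p[of i] that(1) by (auto simp: a_def)
    then show ?thesis using that(4,5) by (auto simp: mod_ker_def)
  qed
  \<comment> \<open>\<open>seg i k\<close> is the product of the \<open>k\<close> factors
    \<open>a (i + k - 1)\<close>, ..., \<open>a i\<close>, with \<open>a i\<close> applied first. It
    is the identity for \<open>k = 0\<close>, so membership in \<open>J\<close> is available only
    from \<open>Suc k\<close> on.\<close>
  define seg where "seg i = rec_nat id (\<lambda>k h. a (i + k) \<circ> h)" for i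
  have seg_0: "seg i 0 = id" and seg_comp: "seg i (Suc k) = a (i + k) \<circ> seg i k" for i k
    by (simp_all add: seg_def)
  have seg_Suc: "seg i (Suc k) x = a (i + k) (seg i k x)" for i k x
    by (simp add: seg_comp)
  have seg_Suc': "seg i (Suc k) x = seg (Suc i) k (a i x)" for i k x
    by (induction k) (simp_all add: seg_0 seg_Suc)
  have seg_p: "seg i k (p i x) = p (i + k) x" for i k x
    by (induction k) (simp_all add: seg_0 seg_Suc p_Suc)
  have seg_J: "seg i (Suc k) \<in> J" for i k
  proof (induction k)
    case 0
    show ?case using a[of i] by (simp add: seg_comp seg_0 comp_def)
  next
    case (Suc k)
    then show ?case unfolding seg_comp[of i "Suc k"] by (intro J_comp a)
  qed
  \<comment> \<open>A product of consecutive factors kills only what its first factor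
    \<open>a i\<close> kills. For \<open>k > 0\<close> this is \<open>a_max\<close> with the later
    factors as \<open>b\<close>, since the products \<open>p\<close> are live.\<close>
  have seg_inj: "a i y = \<zero>\<^bsub>M\<^esub>" if y: "y \<in> carrier M" "seg i (Suc k) y = \<zero>\<^bsub>M\<^esub>" for i k y
  proof (cases k)
    case 0
    then show ?thesis using y(2) by (simp add: seg_0 seg_Suc)
  next
    case (Suc l)
    obtain x where "x \<in> carrier M" "p (i + Suc k) x \<notin> K"
      using p[of "i + Suc k"] by (auto simp: live_def)
    then show ?thesis
      using a_max[of "seg (Suc i) k" x i y] seg_J[of "Suc i" l] y seg_p[of i "Suc k" x] Suc
      by (simp add: seg_Suc')
  qed
  have seg_kills: "seg i k x = \<zero>\<^bsub>M\<^esub>" if "x \<in> annihilator_chain M J k" for i k x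
    using that
  proof (induction k arbitrary: i x)
    case (Suc k)
    then show ?case using a[of i] by (simp add: seg_Suc')
  qed (simp add: seg_0)
  have a_p: "a i (p m x) \<in> K" if im: "i < m" and x: "x \<in> carrier M" for i m x
  proof (rule ccontr)
    assume notin: "a i (p m x) \<notin> K"
    define k where "k = m - Suc i"
    have m: "m = i + Suc k" using im by (simp add: k_def)
    \<comment> \<open>\<open>c\<close> closes a cycle: it first applies \<open>a (i + 1)\<close>,
      ..., \<open>a (m - 1)\<close> and then returns to the image of \<open>a i\<close>.\<close>
    define c where "c = a i \<circ> seg (Suc i) k"
    have c: "c y = a i (seg (Suc i) k y)" for y by (simp add: c_def)
    have "c \<in> J"
    proof (cases k)
      case 0
      then show ?thesis using a[of i] by (simp add: c_def seg_0 comp_def)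
    next
      case (Suc l)
      then show ?thesis unfolding c_def using a seg_J J_comp by blast
    qed
    have "c (a i (p i x)) \<notin> K"
      using notin seg_p[of i "Suc k" x] by (simp add: c m seg_Suc')
    then have cancel: "a i y = \<zero>\<^bsub>M\<^esub>" if "y \<in> carrier M" "c (a i y) = \<zero>\<^bsub>M\<^esub>" for y
      using a_max[OF \<open>c \<in> J\<close> x] that by blast
    have seg_closed: "seg (Suc i) k (a i y) \<in> carrier M" if "y \<in> carrier M" for y
      using J_closed[OF seg_J[of i k] that] by (simp add: seg_Suc')
    have cancel_pow: "a i y = \<zero>\<^bsub>M\<^esub>" if "y \<in> carrier M" "(c ^^ j) (a i y) = \<zero>\<^bsub>M\<^esub>" for j y
      using that
    proof (induction j arbitrary: y)
      case (Suc j)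
      \<comment> \<open>\<open>c (a i y)\<close> is again a value of \<open>a i\<close>, so the
        induction hypothesis applies to it; afterwards \<open>cancel\<close> removes the last
        \<open>c\<close>.\<close>
      have "(c ^^ j) (a i (seg (Suc i) k (a i y))) = \<zero>\<^bsub>M\<^esub>"
        using Suc.prems(2) by (simp add: funpow_Suc_right c[of "a i y"] del: funpow.simps)
      then have "c (a i y) = \<zero>\<^bsub>M\<^esub>"
        using Suc.IH[OF seg_closed[OF Suc.prems(1)]] by (simp add: c[of "a i y"])
      then show ?case using cancel Suc.prems(1) by blast
    qed simp
    obtain j where "\<forall>x\<in>carrier M. (c ^^ j) x = \<zero>\<^bsub>M\<^esub>"
      using nil[OF \<open>c \<in> J\<close>] by (auto simp: nilpotent_endo_def)
    then have "a i y = \<zero>\<^bsub>M\<^esub>" if "y \<in> carrier M" for y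
      using cancel_pow that a_closed by blast
    then show False using notin K(2) p_closed[OF x] by simp
  qed
  \<comment> \<open>There are \<open>n + 1\<close> factors: on the image of a later
    \<open>p m\<close> the first one, \<open>a (Suc i)\<close>, lands in \<open>K\<close>, and the
    remaining \<open>n\<close> kill \<open>K\<close>, the annihilator of \<open>J^n\<close>.\<close>
  define q where "q i = seg (Suc i) (Suc n)" for i
  have q_End: "q i \<in> mod_End R M" for i unfolding q_def by (rule J_End[OF seg_J])
  have q_p: "q i (p m x) = \<zero>\<^bsub>M\<^esub>" if "Suc i < m" "x \<in> carrier M" for i m x
    using seg_kills[of "a (Suc i) (p m x)" n "Suc (Suc i)"] a_p[OF that]
    by (simp add: q_def seg_Suc' K_def)
  have q_a: "a i x = \<zero>\<^bsub>M\<^esub>" if "x \<in> carrier M" "q i (a i x) = \<zero>\<^bsub>M\<^esub>" for i x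
    using seg_inj[OF that(1), of i "Suc n"] that(2) by (simp add: q_def seg_Suc'[of i])
  \<comment> \<open>The \<open>q i\<close> separate the images: \<open>q i\<close> kills
    \<open>V k\<close> for \<open>i < k\<close>, while \<open>q k\<close> vanishes at no nonzero
    element of \<open>V k\<close>. The factor \<open>carrier M\<close> takes care of the empty
    intersection at \<open>k = 0\<close>.\<close>
  define W where "W k = carrier M \<inter> (\<Inter>i<k. mod_ker M M (q i))" for k
  define V where "V k = p (Suc k) ` carrier M" for k
  show False
  proof (rule finite_uniform_dimension_no_chain[OF fud, of W V])
    fix k
    have "W k = \<Inter>(insert (carrier M) ((\<lambda>i. mod_ker M M (q i)) ` {..<k}))"
      by (auto simp: W_def)
    also have "submodule \<dots> R M"
      using submodule_carrier submodule_mod_ker[OF M M q_End] by (intro submodule_Inter) auto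
    finally show "submodule (W k) R M" .
    show "W (Suc k) \<subseteq> W k" by (auto simp: W_def)
    show "submodule (V k) R M"
      unfolding V_def by (rule submodule_image[OF M M conjunct1[OF p] submodule_carrier])
    show "V k \<subseteq> W k"
      using q_p p_closed by (auto simp: V_def W_def mod_ker_def)
    obtain x where "x \<in> carrier M" "p (Suc k) x \<notin> K"
      using p[of "Suc k"] by (auto simp: live_def)
    then show "V k \<noteq> {\<zero>\<^bsub>M\<^esub>}"
      using K(2) unfolding V_def by (metis imageI singletonD)
    show "V k \<inter> W (Suc k) \<subseteq> {\<zero>\<^bsub>M\<^esub>}"
      using q_a p_closed by (auto simp: V_def W_def mod_ker_def p_Suc)
  qed
qed

end

section \<open>Transfer from endomorphisms to powers of the submodule\<close>

theorem theorem5p4: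
  fixes R :: "('a, 'r) ring_scheme" and M :: "('a, 'b, 'm) module_scheme" and N :: "'b set"
  assumes "left_module R M"
    and "power_projective R M"
    and "retractable R M"
    and "Goldie_module R M"
    and "fully_invariant R M N"
    and "N \<noteq> carrier M"
    and "nil_submodule R M N"
  shows "nilpotent_submodule R M N"
proof -
  interpret left_module R M by fact
  have N: "submodule N R M" and nil: "\<And>x f. x \<in> N \<Longrightarrow>
      f \<in> mod_hom R M (M\<lparr>carrier := cyclic_submodule R M x\<rparr>) \<Longrightarrow> nilpotent_endo M f"
    using assms(7) by (auto simp: nil_submodule_def)
  note N' = submoduleD[OF N]
  define J where "J = (\<Union>x\<in>N. mod_hom R M (M\<lparr>carrier := cyclic_submodule R M x\<rparr>))"
  have J_iff: "f \<in> J \<longleftrightarrow> (\<exists>x\<in>N. f \<in> mod_End R M \<and> f ` carrier M \<subseteq> cyclic_submodule R M x)" for f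
  proof -
    have "cyclic_submodule R M x \<subseteq> carrier M" if "x \<in> N" for x
      using cyclic_submodule_subset[OF submodule_carrier N'(1)[OF that]] .
    then show ?thesis
      using mod_hom_restrict_codomain[of _ M f R M] by (simp add: J_def)
  qed
  have J_End: "J \<subseteq> mod_End R M" by (auto simp: J_iff)
  have J_comp: "f \<circ> g \<in> J" if "f \<in> J" "g \<in> J" for f g
  proof -
    from that obtain x where x: "x \<in> N" "f \<in> mod_End R M" "g \<in> mod_End R M"
      "f ` carrier M \<subseteq> cyclic_submodule R M x" by (auto simp: J_iff)
    \<comment> \<open>A composite has its image inside that of the outer map, so it stays in the
      same cyclic submodule.\<close>
    have "(f \<circ> g) ` carrier M \<subseteq> cyclic_submodule R M x"
      using mod_homD(1)[OF x(3)] x(4) by auto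
    with x(1) mod_hom_comp[OF x(3,2)] show ?thesis unfolding J_iff by metis
  qed
  have J_nil: "nilpotent_endo M f" if "f \<in> J" for f
    using nil that by (auto simp: J_def)
  obtain n where n: "annihilator_chain M J n = carrier M"
    using nil_semigroup_nilpotent[OF assms(4) J_End J_comp J_nil] by blast
  note K = submodule_annihilator_chain[OF J_End]
  \<comment> \<open>Every member of \<open>J\<close> moves the chain down one step. Maps into
    \<open>N\<close> inherit this, being pointwise finite sums of such members.\<close>
  have hom_N: "f ` annihilator_chain M J (Suc k) \<subseteq> annihilator_chain M J k"
    if "f \<in> mod_hom R M (M\<lparr>carrier := N\<rparr>)" for f k
    using hom_into_submodule_via_cyclics[OF assms(2) N K that] by (auto simp: J_def)
  \<comment> \<open>Each further factor \<open>N\<close> lowers the bound by one term. The first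
    power \<open>N\<close> is bounded by the top term, which is all of \<open>M\<close>, so the
    exponent needed is \<open>n + 1\<close>.\<close>
  have sub: "submodule_power R M N (Suc l) \<subseteq> annihilator_chain M J k" if "k + l = n" for k l
    using that
  proof (induction l arbitrary: k)
    case 0
    then show ?case using n N'(1) by auto
  next
    case (Suc l)
    then have "submodule_power R M N (Suc l) \<subseteq> annihilator_chain M J (Suc k)"
      by (intro Suc.IH) simp
    then have "\<Union>{f ` submodule_power R M N (Suc l) | f. f \<in> mod_hom R M (M\<lparr>carrier := N\<rparr>)}
        \<subseteq> annihilator_chain M J k"
      using hom_N by blast
    then show ?case
      unfolding submodule_power.simps submodule_prod_def sum_submodules_def by (rule hull_minimal) (rule K)
  qed
  \<comment> \<open>Turns the inclusion of the power in the zero submodule into an equality.\<close>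
  have zero: "\<zero>\<^bsub>M\<^esub> \<in> submodule_power R M N (Suc l)" for l
  proof (cases l)
    case 0
    then show ?thesis using N'(2) by simp
  next
    case (Suc l')
    then show ?thesis
      unfolding Suc submodule_power.simps submodule_prod_def sum_submodules_def hull_def
      using submoduleD(2) by blast
  qed
  have "submodule_power R M N (Suc n) = {\<zero>\<^bsub>M\<^esub>}"
    using sub[of 0 n] zero[of n] by auto
  then show ?thesis unfolding nilpotent_submodule_def by blast
qed

end
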